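(* Let $d\ge2$, $t\ge2$, let $X=\{x_1,\ldots,x_N\}\subset\mathbb S^{d-1}$ be a node-transitive spherical $t$-design, and let its Steiner-normalized Minkowski polytope satisfy $P_X^\circ=cUP_X$ for some $c>0$, $U\in O(d)$. Let $h$ be the common value of $h_{P_X}(x_i)$, and let $r$ and $R$ be the centered inradius and circumradius of $P_X$. Then $$\frac rR=ch^2\ge\eta_{t,d}.$$ If equality $r/R=\eta_{t,d}$ holds, then for each $i$, with $F_i$ the facet of $P_X$ with outer normal $x_i$, the multiset $$\{\langle Ux_i,x_j\rangle:1\le j\le N\}$$ is exactly the Gaussian quadrature multiset when $t$ is odd and the Gauss--Radau quadrature multiset when $t$ is even; that is, its set of values is $\{\xi_0,\ldots,\xi_n\}$ and each $\xi_k$ occurs exactly $N\lambda_k$ times. In particular, if $\lambda_+=\lambda_n$ is the quadrature weight of the largest node $\xi_n=\eta_{t,d}$, then the number of vertices of $F_i$ is $$\#\operatorname{vert}(F_i)=N\lambda_+.$$ More generally (still under equality), every quadrature weight satisfies $N\lambda_k\in\mathbb Z$.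
   Context: $\sigma$ is the normalized (probability) surface measure on the unit sphere $\mathbb S^{d-1}\subset\mathbb R^d$, and $\omega_{d-1}$ is the total $(d-1)$-area of $\mathbb S^{d-1}$. A finite set $X=\{x_1,\ldots,x_N\}\subset\mathbb S^{d-1}$ of $N$ distinct points is a spherical $t$-design if $\frac1N\sum_i p(x_i)=\int p\,d\sigma$ for every polynomial $p$ of total degree at most $t$. It is node-transitive if some subgroup $G\le O(d)$ preserves $X$ and acts transitively on it. For $t\ge2$, the Minkowski polytope $P_X\subset\mathbb R^d$ is the full-dimensional convex polytope, unique up to translation, whose surface area measure is $\frac{\omega_{d-1}}N\sum_i\delta_{x_i}$: it has exactly $N$ facets, with outer unit normals $x_1,\ldots,x_N$, each of $(d-1)$-area $\omega_{d-1}/N$. It is Steiner-normalized: the translate is chosen so that the Steiner point $d\int_{\mathbb S^{d-1}}h_{P_X}(u)u\,d\sigma(u)$ is $0$, which implies $0\in\operatorname{int}P_X$. Here $h_P(u)=\max_{y\in P}\langle u,y\rangle$ and $P^\circ=\{z:\langle z,y\rangle\le1\ \forall y\in P\}$. For node-transitive $X$ all $h_{P_X}(x_i)$ are equal, to $h$ say. The centered inradius $r$ is the largest radius of an origin-centered ball contained in $P_X$ and the centered circumradius $R$ is the smallest radius of an origin-centered ball containing $P_X$; here all facet hyperplanes are at distance $r=h$ from $0$ and all vertices have norm $R=1/(ch)$. Quadrature data. Let $\mu_d$ be the distribution of the first coordinate of a uniform random point of $\mathbb S^{d-1}$, i.e. $d\mu_d(s)=c_d(1-s^2)^{(d-3)/2}ds$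 on $[-1,1]$ with $c_d$ normalizing. Let $p_k$ be the degree-$k$ orthogonal polynomial for $\mu_d$, and $p_k^+$ the degree-$k$ orthogonal polynomial for $(1+s)\,d\mu_d(s)$. If $t=2n+1$, $\eta_{t,d}$ is the largest zero of $p_{n+1}$, the nodes $\xi_0<\cdots<\xi_n=\eta_{t,d}$ are the zeros of $p_{n+1}$, and $\lambda_0,\ldots,\lambda_n>0$ are the Gaussian quadrature weights. If $t=2n$, $\eta_{t,d}$ is the largest zero of $p_n^+$, the nodes are $-1=\xi_0<\xi_1<\cdots<\xi_n=\eta_{t,d}$ with $\xi_1,\ldots,\xi_n$ the zeros of $p_n^+$, and $\lambda_0,\ldots,\lambda_n>0$ are the Gauss--Radau weights with prescribed node $-1$. In both cases the weights are the unique ones with $\sum_k\lambda_kq(\xi_k)=\int q\,d\mu_d$ for all polynomials $q$ of degree $\le t$. *)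

theory Defs
  imports "HOL-Analysis.Analysis" "HOL-Computational_Algebra.Polynomial" "HOL-Library.Multiset"
begin

section \<open>Surface measure and spherical designs\<close>

text \<open>The ambient space \<open>'a::euclidean_space\<close> plays the role of Euclidean \<open>d\<close>-space with
  \<open>d = DIM('a)\<close>. The surface measure of the unit sphere is defined by the usual sector formula: the
  area of \<open>A\<close> is \<open>d\<close> times the volume of \<open>{x \<in> ball 0 1. x / norm x \<in> A}\<close>. It is a Borel measure
  on the whole space, concentrated on the sphere.\<close>

definition sphere_surface :: "'a::euclidean_space measure" where
  "sphere_surface =
     scale_measure (of_nat DIM('a)) (distr (restrict_space lborel (ball 0 1)) borel sgn)"

definition sphere_prob :: "'a::euclidean_space measure" where
  "sphere_prob = uniform_measure sphere_surface UNIV"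

text \<open>Polynomial functions of total degree at most \<open>t\<close>. An exponent vector is a function
  \<open>\<alpha>\<close>, of which only the values on \<open>Basis\<close> matter.\<close>

definition poly_fun_deg_le :: "nat \<Rightarrow> ('a::euclidean_space \<Rightarrow> real) \<Rightarrow> bool" where
  "poly_fun_deg_le t p \<longleftrightarrow>
     (\<exists>(A :: ('a \<Rightarrow> nat) set) c. finite A \<and> (\<forall>\<alpha>\<in>A. (\<Sum>b\<in>Basis. \<alpha> b) \<le> t) \<and>
        p = (\<lambda>x. \<Sum>\<alpha>\<in>A. c \<alpha> * (\<Prod>b\<in>Basis. (x \<bullet> b) ^ \<alpha> b)))"

definition spherical_design :: "nat \<Rightarrow> 'a::euclidean_space set \<Rightarrow> bool" where
  "spherical_design t X \<longleftrightarrow> finite X \<and> X \<subseteq> sphere 0 1 \<and>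
     (\<forall>p. poly_fun_deg_le t p \<longrightarrow>
        (\<Sum>x\<in>X. p x) / real (card X) = (\<integral>u. p u \<partial>sphere_prob))"

definition orthogonal_subgroup :: "('a::euclidean_space \<Rightarrow> 'a) set \<Rightarrow> bool" where
  "orthogonal_subgroup G \<longleftrightarrow> (\<forall>g\<in>G. orthogonal_transformation g) \<and> id \<in> G \<and>
     (\<forall>g\<in>G. \<forall>k\<in>G. g \<circ> k \<in> G) \<and> (\<forall>g\<in>G. inv g \<in> G)"

definition node_transitive :: "'a::euclidean_space set \<Rightarrow> bool" where
  "node_transitive X \<longleftrightarrow>
     (\<exists>G. orthogonal_subgroup G \<and> (\<forall>g\<in>G. g ` X = X) \<and> (\<forall>x\<in>X. \<forall>y\<in>X. \<exists>g\<in>G. g x = y))"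

section \<open>Convex bodies and the Minkowski polytope\<close>

text \<open>For nonempty compact \<open>P\<close> the supremum is a maximum.\<close>

definition support_fun :: "'a::euclidean_space set \<Rightarrow> 'a \<Rightarrow> real" where
  "support_fun P u = (SUP y\<in>P. u \<bullet> y)"

definition support_face :: "'a::euclidean_space set \<Rightarrow> 'a \<Rightarrow> 'a set" where
  "support_face P u = {y \<in> P. u \<bullet> y = support_fun P u}"

definition polar_body :: "'a::euclidean_space set \<Rightarrow> 'a set" where
  "polar_body P = {z. \<forall>y\<in>P. z \<bullet> y \<le> 1}"

definition steiner_point :: "'a::euclidean_space set \<Rightarrow> 'a" where
  "steiner_point P = real DIM('a) *\<^sub>R (\<integral>u. support_fun P u *\<^sub>R u \<partial>sphere_prob)"

text \<open>For compact \<open>P\<close> with \<open>0 \<in> P\<close> the supremum and the infimum below are attained.\<close>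

definition centered_inradius :: "'a::euclidean_space set \<Rightarrow> real" where
  "centered_inradius P = Sup {\<rho>. 0 \<le> \<rho> \<and> cball 0 \<rho> \<subseteq> P}"

definition centered_circumradius :: "'a::euclidean_space set \<Rightarrow> real" where
  "centered_circumradius P = Inf {\<rho>. 0 \<le> \<rho> \<and> P \<subseteq> cball 0 \<rho>}"

text \<open>The \<open>(d-1)\<close>-area of a set \<open>F\<close> lying in a hyperplane with unit normal \<open>u\<close>, as the
  \<open>d\<close>-volume of the right prism of height 1 over \<open>F\<close>.\<close>

definition flat_area :: "'a::euclidean_space \<Rightarrow> 'a set \<Rightarrow> real" where
  "flat_area u F = measure lebesgue {y + s *\<^sub>R u | y s. y \<in> F \<and> 0 \<le> s \<and> s \<le> 1}"

definition outer_unit_normals :: "'a::euclidean_space set \<Rightarrow> 'a set" where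
  "outer_unit_normals P = {u. norm u = 1 \<and> support_face P u facet_of P}"

text \<open>The surface area measure of a full-dimensional polytope has at each outer unit facet normal
  an atom whose mass is the area of that facet, and no other mass. Here it is prescribed to be the
  sum of the point masses \<open>\<omega> / card X\<close> at the points of \<open>X\<close>, where \<open>\<omega>\<close> is the area of the
  unit sphere.\<close>

definition minkowski_polytope :: "'a::euclidean_space set \<Rightarrow> 'a set \<Rightarrow> bool" where
  "minkowski_polytope X P \<longleftrightarrow> polytope P \<and> aff_dim P = int DIM('a) \<and>
     outer_unit_normals P = X \<and>
     (\<forall>x\<in>X. flat_area x (support_face P x) =
        measure (sphere_surface :: 'a measure) UNIV / real (card X))"

section \<open>Quadrature data\<close>

definition mu_weight :: "nat \<Rightarrow> real \<Rightarrow> real" where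
  "mu_weight d s = indicator {-1..1} s * (1 - s\<^sup>2) powr ((real d - 3) / 2)"

definition mu :: "nat \<Rightarrow> real measure" where
  "mu d = density lborel (\<lambda>s. ennreal (mu_weight d s / (\<integral>v. mu_weight d v \<partial>lborel)))"

definition mu_plus :: "nat \<Rightarrow> real measure" where
  "mu_plus d = density (mu d) (\<lambda>s. ennreal (1 + s))"

text \<open>Orthogonal polynomials are determined up to a nonzero scalar; the monic one is chosen. Only
  their zeros are used.\<close>

definition orth_poly :: "real measure \<Rightarrow> nat \<Rightarrow> real poly" where
  "orth_poly M k = (THE p. degree p = k \<and> lead_coeff p = 1 \<and>
     (\<forall>q. degree q < k \<longrightarrow> (\<integral>s. poly p s * poly q s \<partial>M) = 0))"

text \<open>For \<open>t = 2 n + 1\<close> this is \<open>p\<^bsub>n+1\<^esub>\<close>, and for \<open>t = 2 n\<close> it is the polynomial of degree \<open>n\<close>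
  for \<open>(1 + s) d\<mu>(s)\<close>; in both cases \<open>n = t div 2\<close>.\<close>

definition quad_poly :: "nat \<Rightarrow> nat \<Rightarrow> real poly" where
  "quad_poly t d =
     (if odd t then orth_poly (mu d) (t div 2 + 1) else orth_poly (mu_plus d) (t div 2))"

definition quad_eta :: "nat \<Rightarrow> nat \<Rightarrow> real" where
  "quad_eta t d = Max {s. poly (quad_poly t d) s = 0}"

definition quad_nodes :: "nat \<Rightarrow> nat \<Rightarrow> real set" where
  "quad_nodes t d = {s. poly (quad_poly t d) s = 0} \<union> (if odd t then {} else {-1})"

text \<open>The nodes \<open>\<xi>\<^sub>0 < \<dots> < \<xi>\<^sub>n\<close> in increasing order.\<close>

definition quad_node :: "nat \<Rightarrow> nat \<Rightarrow> nat \<Rightarrow> real" where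
  "quad_node t d k = sorted_list_of_set (quad_nodes t d) ! k"

text \<open>The weights \<open>\<lambda>\<^sub>0, \<dots>, \<lambda>\<^sub>n\<close>. The value 0 beyond \<open>n\<close> only makes the function unique.\<close>

definition quad_weight :: "nat \<Rightarrow> nat \<Rightarrow> nat \<Rightarrow> real" where
  "quad_weight t d = (THE w. (\<forall>k>t div 2. w k = 0) \<and>
     (\<forall>q. degree q \<le> t \<longrightarrow>
        (\<Sum>k\<le>t div 2. w k * poly q (quad_node t d k)) = (\<integral>s. poly q s \<partial>mu d)))"

end

theory Submission
  imports Defs "HOL-Probability.Probability"
begin

text \<open>
Since all support numbers equal \<open>h\<close>, the polytope is \<open>P = {y. \<forall>x\<in>X. x \<bullet> y \<le> h}\<close> and its polar is
the convex hull of the points \<open>x / h\<close>. Self-polarity then says that the vertices of \<open>P\<close> are the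
points \<open>U\<^sup>-\<^sup>1 y / (c h)\<close> with \<open>y \<in> X\<close> (\<open>vertices_of_self_polar\<close>). They all have norm \<open>1 / (c h)\<close>,
so the ratio of the radii is \<open>c h\<^sup>2\<close>. That every vertex satisfies every facet inequality reads
\<open>U x \<bullet> y \<le> c h\<^sup>2\<close> for all \<open>x, y \<in> X\<close>, and the vertex given by \<open>y\<close> lies on the facet with normal
\<open>x\<close> if and only if equality holds.

Fix \<open>x\<close>. By the design property, averaging a polynomial \<open>q\<close> of degree at most \<open>t\<close> over the \<open>N\<close>
numbers \<open>U x \<bullet> y\<close> gives its integral over the sphere along the direction \<open>U x\<close>, which is the
integral of \<open>q\<close> against \<open>\<mu>\<close> (\<open>integral_zonal\<close>). The claim is thus one about the real line: an
equal-weight quadrature rule on \<open>[-1, 1]\<close> that is exact up to degree \<open>t\<close> has a node at or beyond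
\<open>\<eta>\<close>. The polynomial \<open>w (s - \<eta>) \<Prod> (s - a)\<^sup>2\<close> over the other zeros \<open>a\<close>, with \<open>w = 1\<close> or
\<open>w = 1 + s\<close>, has degree \<open>t\<close> and integral zero by orthogonality, but is negative on \<open>(-1, \<eta>)\<close>
away from the nodes. If all values are at most \<open>\<eta>\<close>, they are therefore nodes
(\<open>values_in_nodes\<close>), and \<open>\<eta>\<close> itself has to occur (\<open>exists_value_ge_eta\<close>). This is the
inequality. In the case of equality all values are nodes, and since a rule on \<open>n + 1\<close> given nodes
is determined by its exactness, the multiplicities are \<open>N\<close> times the quadrature weights
(\<open>node_multiplicities\<close>); the multiplicity of \<open>\<eta>\<close> counts the vertices of the facet.

Two supporting theories are developed first. Zeros of orthogonal polynomials are treated for an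
abstract positive functional on polynomials. The marginal of the sphere measure is found by
moments: on both sides \<open>(k + d) m\<^bsub>k+2\<^esub> = (k + 1) m\<^bsub>k\<^esub>\<close>, for \<open>\<mu>\<close> by integrating a derivative,
and for the sphere by evaluating a Gaussian integral both in polar coordinates and by the
distribution of a linear form.
\<close>

section \<open>Orthogonal polynomials of a positive functional\<close>

text \<open>The orthogonality theory uses only the values of the functional on polynomials. This form covers
both \<open>\<mu>\<close> and \<open>(1 + s) \<mu>\<close>; for the latter it matters that positivity is asked for on the open
interval, where the factor \<open>1 + s\<close> does not vanish.\<close>

locale positive_functional =
  fixes L :: "real poly \<Rightarrow> real"
  assumes add: "L (p + q) = L p + L q"
    and smult: "L (smult a p) = a * L p"
    and pos: "q \<noteq> 0 \<Longrightarrow> (\<And>s. -1 < s \<Longrightarrow> s < 1 \<Longrightarrow> poly q s \<ge> 0) \<Longrightarrow> L q > 0"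
begin

lemma diff: "L (p - q) = L p - L q"
  using add[of p "smult (-1) q"] smult[of "-1" q] by simp

text \<open>The bound on the degree is expressed through coefficients, so that for \<open>k = 0\<close> only the zero
polynomial is tested and inductions can start there.\<close>

definition perp :: "nat \<Rightarrow> real poly \<Rightarrow> bool" where
  "perp k p \<longleftrightarrow> (\<forall>q. (\<forall>i\<ge>k. coeff q i = 0) \<longrightarrow> L (p * q) = 0)"

lemma perp_iff_degree:
  assumes "k > 0"
  shows "perp k p \<longleftrightarrow> (\<forall>q. degree q < k \<longrightarrow> L (p * q) = 0)"
proof -
  have "(\<forall>i\<ge>k. coeff q i = 0) \<longleftrightarrow> degree q < k" for q :: "real poly"
    using assms by (metis coeff_eq_0 le_degree leading_coeff_neq_0 not_le
      order_less_le_trans degree_0)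
  then show ?thesis by (simp add: perp_def)
qed

text \<open>Gram--Schmidt without keeping an orthogonal basis: in the step from \<open>k\<close> to \<open>k + 1\<close>, the residual
\<open>p\<close> of \<open>x\<^sup>k\<close> is the only new direction, and subtracting the right multiple of it repairs the
orthogonality that is still missing.\<close>

lemma projection_exists: "\<exists>r. (\<forall>i\<ge>k. coeff r i = 0) \<and> perp k (f - r)"
proof (induction k arbitrary: f)
  case 0
  have "q = 0" if "\<forall>i\<ge>0. coeff q i = 0" for q :: "real poly"
    using that by (simp add: poly_eq_iff)
  then have "perp 0 f"
    using smult[of 0 0] unfolding perp_def by (metis mult_zero_right smult_0_right mult_zero_left)
  then show ?case by (intro exI[of _ 0]) simp
next
  case (Suc k)
  obtain r0 where r0: "\<forall>i\<ge>k. coeff r0 i = 0" "perp k (f - r0)" using Suc by blast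
  obtain r1 where r1: "\<forall>i\<ge>k. coeff r1 i = 0" "perp k (monom 1 k - r1)" using Suc by blast
  define p where "p = monom 1 k - r1"
  have pk: "coeff p k = 1" using r1 by (simp add: p_def)
  have p_high: "coeff p i = 0" if "i > k" for i using that r1 by (simp add: p_def)
  have p_perp: "perp k p" using r1 by (simp add: p_def)
  have "p \<noteq> 0" using pk by auto
  then have Lpp: "L (p * p) > 0" by (intro pos) auto
  define c where "c = L (f * p) / L (p * p)"
  have "L ((f - (r0 + smult c p)) * q) = 0" if q: "\<forall>i\<ge>Suc k. coeff q i = 0" for q
  proof -
    define q' where "q' = q - smult (coeff q k) p"
    have q'_low: "\<forall>i\<ge>k. coeff q' i = 0"
    proof (intro allI impI)
      fix i assume "i \<ge> k"
      then consider "i = k" | "i > k" by linarith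
      then show "coeff q' i = 0" using q pk p_high by cases (auto simp: q'_def)
    qed
    have 1: "L ((f - r0) * q') = 0" using r0(2) q'_low by (auto simp: perp_def)
    have 2: "L (p * q') = 0" using p_perp q'_low by (auto simp: perp_def)
    have 3: "L (p * r0) = 0" using p_perp r0(1) by (auto simp: perp_def)
    have "(f - (r0 + smult c p)) * q =
      ((f - r0) * q' - smult c (p * q')) + smult (coeff q k) (f * p - p * r0 - smult c (p * p))"
      by (simp add: q'_def algebra_simps smult_add_right smult_diff_right)
    then show ?thesis
      using 1 2 3 Lpp by (simp add: add diff smult c_def)
  qed
  then have "perp (Suc k) (f - (r0 + smult c p))" by (auto simp: perp_def)
  moreover have "\<forall>i\<ge>Suc k. coeff (r0 + smult c p) i = 0" using r0 p_high by auto
  ultimately show ?case by blast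
qed

text \<open>Existence is the residual of \<open>x\<^sup>k\<close>. Two monic solutions differ by a polynomial of degree below
\<open>k\<close>, which is then orthogonal to itself, hence zero by positivity.\<close>

lemma ex1_monic_orthogonal:
  "\<exists>!p. degree p = k \<and> lead_coeff p = 1 \<and> (\<forall>q. degree q < k \<longrightarrow> L (p * q) = 0)"
proof (cases "k = 0")
  case True
  have "p = 1" if "degree p = 0" "lead_coeff p = 1" for p :: "real poly"
    using that by (metis degree_eq_zeroE coeff_pCons_0 one_pCons)
  then show ?thesis using True by (intro ex1I[of _ 1]) auto
next
  case False
  then have k: "k > 0" by simp
  obtain r where r: "\<forall>i\<ge>k. coeff r i = 0" "perp k (monom 1 k - r)"
    using projection_exists by blast
  let ?p = "monom 1 k - r"
  have "coeff ?p k = 1" "\<forall>i>k. coeff ?p i = 0" using r by auto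
  then have deg: "degree ?p = k" "lead_coeff ?p = 1"
    by (metis (no_types, lifting) degree_le le_antisym le_degree one_neq_zero)
       (metis (no_types, lifting) \<open>coeff ?p k = 1\<close> \<open>\<forall>i>k. coeff ?p i = 0\<close> degree_le le_antisym le_degree one_neq_zero)
  show ?thesis
  proof (rule ex1I[of _ ?p])
    show "degree ?p = k \<and> lead_coeff ?p = 1 \<and> (\<forall>q. degree q < k \<longrightarrow> L (?p * q) = 0)"
      using deg r(2) k perp_iff_degree by blast
  next
    fix p assume p: "degree p = k \<and> lead_coeff p = 1 \<and> (\<forall>q. degree q < k \<longrightarrow> L (p * q) = 0)"
    have low: "degree (p - ?p) < k"
    proof -
      have "coeff (p - ?p) i = 0" if "i \<ge> k" for i
        using that p deg r(1) by (cases "i = k") (auto simp: coeff_eq_0)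
      then show ?thesis using k by (metis degree_0 leading_coeff_neq_0 not_le)
    qed
    then have "L (p * (p - ?p)) = 0" "L (?p * (p - ?p)) = 0"
      using p r(2) k perp_iff_degree by blast+
    then have "L ((p - ?p) * (p - ?p)) = 0" by (metis diff left_diff_distrib diff_zero)
    moreover have "p - ?p \<noteq> 0 \<Longrightarrow> L ((p - ?p) * (p - ?p)) > 0"
      by (intro pos) auto
    ultimately show "p = ?p" by force
  qed
qed

end

text \<open>The set \<open>A\<close> consists of the roots of odd order in the open interval. Splitting off one linear
factor toggles the membership of its root, so multiplicities never have to be counted.\<close>

lemma sign_correcting_roots:
  fixes p :: "real poly"
  assumes "p \<noteq> 0"
  shows "\<exists>A \<sigma>. finite A \<and> card A \<le> degree p \<and> A \<subseteq> {-1<..<1} \<and> (\<forall>a\<in>A. poly p a = 0) \<and>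
    (\<sigma> = 1 \<or> \<sigma> = -1) \<and> (\<forall>s. -1 < s \<longrightarrow> s < 1 \<longrightarrow> \<sigma> * poly (p * (\<Prod>a\<in>A. [:-a, 1:])) s \<ge> 0)"
  using assms
proof (induction "degree p" arbitrary: p rule: less_induct)
  case less
  show ?case
  proof (cases "\<exists>a. -1 < a \<and> a < 1 \<and> poly p a = 0")
    case False
    have "(\<forall>s. -1 < s \<longrightarrow> s < 1 \<longrightarrow> poly p s \<ge> 0) \<or> (\<forall>s. -1 < s \<longrightarrow> s < 1 \<longrightarrow> poly p s \<le> 0)"
    proof (rule ccontr)
      assume "\<not> ?thesis"
      then obtain s u where s: "-1 < s" "s < 1" "poly p s < 0" and u: "-1 < u" "u < 1" "poly p u > 0"
        by (auto simp: not_le)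
      have "s \<noteq> u" using s u by auto
      then show False
        using poly_IVT_pos[of s u p] poly_IVT_neg[of u s p] s u False
        by (metis less_trans linorder_neqE_linordered_idom)
    qed
    then show ?thesis
      by (elim disjE) (intro exI[of _ "{}"] exI[of _ 1], simp, intro exI[of _ "{}"] exI[of _ "-1"], simp)
  next
    case True
    then obtain a where a: "-1 < a" "a < 1" "poly p a = 0" by blast
    obtain p' where p': "p = [:-a, 1:] * p'" using a(3) by (metis dvdE poly_eq_0_iff_dvd)
    have "p' \<noteq> 0" using p' less.prems by auto
    have deg: "degree p = Suc (degree p')"
      unfolding p' by (subst degree_mult_eq) (use \<open>p' \<noteq> 0\<close> in auto)
    obtain A \<sigma> where A: "finite A" "card A \<le> degree p'" "A \<subseteq> {-1<..<1}" "\<forall>a\<in>A. poly p' a = 0"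
      "\<sigma> = 1 \<or> \<sigma> = -1"
      "\<And>s. -1 < s \<Longrightarrow> s < 1 \<Longrightarrow> \<sigma> * poly (p' * (\<Prod>a\<in>A. [:-a, 1:])) s \<ge> 0"
      using less.hyps[of p'] deg \<open>p' \<noteq> 0\<close> by auto
    show ?thesis
    proof (cases "a \<in> A")
      case True
      have "p * (\<Prod>a\<in>A - {a}. [:-a, 1:]) = p' * (\<Prod>a\<in>A. [:-a, 1:])"
        unfolding p' prod.remove[OF A(1) True] by (simp only: mult_ac)
      moreover have "\<forall>b\<in>A - {a}. poly p b = 0" using A(4) by (simp add: p')
      moreover have "card (A - {a}) \<le> degree p"
        using A(1,2) deg True by (simp add: card_Diff_singleton)
      ultimately show ?thesis
        using A by (intro exI[of _ "A - {a}"] exI[of _ \<sigma>]) auto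
    next
      case False
      have "p * (\<Prod>a\<in>insert a A. [:-a, 1:]) = ([:-a, 1:] * [:-a, 1:]) * (p' * (\<Prod>a\<in>A. [:-a, 1:]))"
        unfolding p' prod.insert[OF A(1) False] by (simp only: mult_ac)
      then have "\<sigma> * poly (p * (\<Prod>a\<in>insert a A. [:-a, 1:])) s
          = (s - a)\<^sup>2 * (\<sigma> * poly (p' * (\<Prod>a\<in>A. [:-a, 1:])) s)" for s
        by (simp add: power2_eq_square algebra_simps)
      then have "\<sigma> * poly (p * (\<Prod>a\<in>insert a A. [:-a, 1:])) s \<ge> 0" if "-1 < s" "s < 1" for s
        using A(6)[OF that] by (metis mult_nonneg_nonneg zero_le_power2)
      moreover have "\<forall>b\<in>insert a A. poly p b = 0" using A(4) by (simp add: p')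
      moreover have "card (insert a A) \<le> degree p" using A(1,2) deg False by simp
      ultimately show ?thesis
        using A(1,3,5) a by (intro exI[of _ "insert a A"] exI[of _ \<sigma>]) (simp del: poly_mult)
    qed
  qed
qed

context positive_functional
begin

text \<open>With fewer than \<open>k\<close> sign changes, the correcting product would have degree below \<open>k\<close>, hence be
orthogonal to \<open>p\<close>, although its product with \<open>p\<close> has constant sign. So all \<open>k\<close> roots are
simple and lie in the open interval.\<close>

lemma orthogonal_roots:
  assumes "degree p = k" "lead_coeff p = 1" and orth: "\<And>q. degree q < k \<Longrightarrow> L (p * q) = 0"
  shows "{s. poly p s = 0} \<subseteq> {-1<..<1} \<and> card {s. poly p s = 0} = k \<and>
    p = (\<Prod>a\<in>{s. poly p s = 0}. [:-a, 1:])"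
proof -
  have p0: "p \<noteq> 0" using assms by auto
  obtain A \<sigma> where A: "finite A" "card A \<le> degree p" "A \<subseteq> {-1<..<1}" "\<forall>a\<in>A. poly p a = 0"
      "\<sigma> = 1 \<or> \<sigma> = -1"
      "\<And>s. -1 < s \<Longrightarrow> s < 1 \<Longrightarrow> \<sigma> * poly (p * (\<Prod>a\<in>A. [:-a, 1:])) s \<ge> 0"
    using sign_correcting_roots[OF p0] by auto
  let ?q = "\<Prod>a\<in>A. [:-a, 1:]"
  have q0: "?q \<noteq> 0" using A(1) by simp
  have degq: "degree ?q = card A" by (subst degree_prod_eq_sum_degree) auto
  have "L (smult \<sigma> (p * ?q)) > 0"
    using A(5,6) p0 q0 by (intro pos) auto
  then have "\<not> card A < k" using orth[of ?q] degq by (auto simp: smult)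
  then have card: "card A = k" using A(2) assms(1) by simp
  have fin: "finite {s. poly p s = 0}" using p0 by (rule poly_roots_finite)
  have "card {s. poly p s = 0} \<le> k" using card_poly_roots_bound[OF p0] assms(1) by simp
  then have Aeq: "A = {s. poly p s = 0}"
    using card_subset_eq[OF fin, of A] A(4) card card_mono[OF fin, of A] by auto
  have lc: "lead_coeff ?q = 1" by (simp add: lead_coeff_prod)
  have "p - ?q = 0"
  proof (rule ccontr)
    assume nz: "p - ?q \<noteq> 0"
    have "A \<subseteq> {s. poly (p - ?q) s = 0}"
      using A(1,4) by (auto simp: poly_prod)
    then have "card A \<le> card {s. poly (p - ?q) s = 0}"
      by (rule card_mono[OF poly_roots_finite[OF nz]])
    then have "k \<le> degree (p - ?q)"
      using card_poly_roots_bound[OF nz] card by linarith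
    moreover have "coeff (p - ?q) i = 0" if "i \<ge> k" for i
      using that assms(1,2) lc degq card by (cases "i = k") (auto simp: coeff_eq_0)
    ultimately show False using nz leading_coeff_neq_0 by blast
  qed
  then show ?thesis using Aeq A(3) card by auto
qed

end

section \<open>The marginal measure on the interval\<close>

lemma mu_weight_nonneg: "mu_weight d s \<ge> 0"
  by (simp add: mu_weight_def)

lemma mu_weight_measurable [measurable]: "mu_weight d \<in> borel_measurable borel"
  unfolding mu_weight_def by measurable

text \<open>This is the case \<open>d = 2\<close>, the most singular one. Its primitive is the arcsine, and it dominates
the weights of all higher dimensions.\<close>

lemma integrable_inverse_sqrt_one_minus_square:
  "integrable lborel (\<lambda>s::real. indicator {-1..1} s * inverse (sqrt (1 - s\<^sup>2)))"
proof -
  let ?f = "\<lambda>s::real. indicator {-1..1} s * inverse (sqrt (1 - s\<^sup>2))"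
  have "((\<lambda>s. inverse (sqrt (1 - s\<^sup>2))) has_integral (arcsin 1 - arcsin (-1))) {-1..1::real}"
  proof (rule fundamental_theorem_of_calculus_interior)
    fix s :: real assume "s \<in> {-1<..<1}"
    then show "(arcsin has_vector_derivative inverse (sqrt (1 - s\<^sup>2))) (at s)"
      using DERIV_arcsin[of s] by (simp add: has_real_derivative_iff_has_vector_derivative)
  qed (auto intro: continuous_on_arcsin')
  then have "((\<lambda>s. if s \<in> {-1..1} then inverse (sqrt (1 - s\<^sup>2)) else 0) has_integral
      (arcsin 1 - arcsin (-1))) (UNIV :: real set)"
    by (subst has_integral_restrict_UNIV)
  also have "(\<lambda>s. if s \<in> {-1..1} then inverse (sqrt (1 - s\<^sup>2)) else 0) = ?f"
    by (auto simp: fun_eq_iff indicator_def)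
  finally have hi: "(?f has_integral (arcsin 1 - arcsin (-1))) UNIV" .
  have nn: "?f s \<ge> 0" for s
    by (cases "s \<in> {-1..1}") (auto simp: abs_square_le_1 abs_le_iff)
  have "integral\<^sup>N lborel ?f = ennreal (arcsin 1 - arcsin (-1))"
    by (rule nn_integral_has_integral_lborel[OF _ nn hi]) measurable
  then show ?thesis
    using nn by (intro integrableI_nn_integral_finite[where x = "arcsin 1 - arcsin (-1)"]) auto
qed

lemma integrable_mu_weight:
  assumes "d \<ge> 2"
  shows "integrable lborel (mu_weight d)"
proof (rule Bochner_Integration.integrable_bound[OF integrable_inverse_sqrt_one_minus_square])
  show "AE s in lborel. norm (mu_weight d s) \<le> norm (indicator {-1..1} s * inverse (sqrt (1 - s\<^sup>2)) :: real)"
  proof (rule AE_I2)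
    fix s :: real
    show "norm (mu_weight d s) \<le> norm (indicator {-1..1} s * inverse (sqrt (1 - s\<^sup>2)) :: real)"
    proof (cases "s \<in> {-1<..<1}")
      case True
      then have b: "1 - s\<^sup>2 > 0" "1 - s\<^sup>2 \<le> 1" by (auto simp: abs_square_less_1 abs_less_iff)
      have "(1 - s\<^sup>2) powr ((real d - 3) / 2) \<le> (1 - s\<^sup>2) powr (- (1/2))"
        using assms b by (intro powr_mono') auto
      also have "\<dots> = inverse (sqrt (1 - s\<^sup>2))" using b by (simp add: powr_minus powr_half_sqrt)
      finally show ?thesis using True b by (simp add: mu_weight_def)
    next
      case False
      then consider "s = 1" | "s = -1" | "s \<notin> {-1..1}" by force
      then show ?thesis by cases (auto simp: mu_weight_def)
    qed
  qed
qed simp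

lemma integrable_poly_mu_weight:
  assumes "d \<ge> 2"
  shows "integrable lborel (\<lambda>s. poly q s * mu_weight d s)"
proof -
  have "compact (poly q ` {-1..1})"
    by (intro compact_continuous_image continuous_on_poly continuous_on_id) simp
  then obtain B where B: "\<forall>s\<in>{-1..1}. \<bar>poly q s\<bar> \<le> B"
    using compact_imp_bounded[of "poly q ` {-1..1}"] by (auto simp: bounded_iff)
  show ?thesis
  proof (rule Bochner_Integration.integrable_bound)
    show "integrable lborel (\<lambda>s. B * mu_weight d s)" using integrable_mu_weight[OF assms] by simp
    show "AE s in lborel. norm (poly q s * mu_weight d s) \<le> norm (B * mu_weight d s)"
    proof (rule AE_I2)
      fix s :: real
      show "norm (poly q s * mu_weight d s) \<le> norm (B * mu_weight d s)"
      proof (cases "s \<in> {-1..1}")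
        case True
        then have "\<bar>poly q s\<bar> \<le> \<bar>B\<bar>" using bspec[OF B True] by linarith
        then show ?thesis by (simp add: abs_mult mult_right_mono)
      qed (simp add: mu_weight_def)
    qed
  qed (use borel_measurable_continuous_onI[of "poly q"] in \<open>simp add: continuous_on_poly\<close>)
qed

text \<open>The weight is positive on the open interval and a nonzero polynomial has finitely many zeros, so
the integrand cannot vanish almost everywhere.\<close>

lemma integral_poly_mu_weight_pos:
  assumes "d \<ge> 2" "q \<noteq> 0" and nonneg: "\<And>s. -1 < s \<Longrightarrow> s < 1 \<Longrightarrow> poly q s \<ge> 0"
  shows "(\<integral>s. poly q s * mu_weight d s \<partial>lborel) > 0"
proof -
  have nn: "poly q s * mu_weight d s \<ge> 0" for s
  proof (cases "s \<in> {-1<..<1}")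
    case False
    then consider "s = 1" | "s = -1" | "s \<notin> {-1..1}" by force
    then show ?thesis by cases (auto simp: mu_weight_def)
  qed (use nonneg mu_weight_nonneg in auto)
  have "(\<integral>s. poly q s * mu_weight d s \<partial>lborel) \<noteq> 0"
  proof
    assume "(\<integral>s. poly q s * mu_weight d s \<partial>lborel) = 0"
    then have 0: "AE s in lborel. poly q s * mu_weight d s = 0"
      using integral_nonneg_eq_0_iff_AE[OF integrable_poly_mu_weight[OF assms(1)]] nn by simp
    have "countable {s. poly q s = 0}"
      using poly_roots_finite[OF assms(2)] by (rule countable_finite)
    then have "AE s in lborel. poly q s \<noteq> 0"
      using countable_imp_null_set_lborel AE_not_in[of "{s. poly q s = 0}" lborel] by auto
    with 0 have "AE s in lborel. s \<notin> {-1<..<1::real}"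
    proof eventually_elim
      case (elim s)
      show ?case
      proof
        assume s: "s \<in> {-1<..<1}"
        then have "s\<^sup>2 < 1" by (auto simp: abs_square_less_1 abs_less_iff)
        then have "mu_weight d s > 0" using s by (simp add: mu_weight_def)
        then show False using elim by simp
      qed
    qed
    then have "emeasure lborel {-1<..<1::real} = 0"
      by (subst (asm) AE_iff_measurable[of "{-1<..<1}"]) auto
    then show False by simp
  qed
  moreover have "(\<integral>s. poly q s * mu_weight d s \<partial>lborel) \<ge> 0"
    using nn by (intro integral_nonneg_AE) auto
  ultimately show ?thesis by linarith
qed

lemma integral_poly_mu:
  assumes "d \<ge> 2"
  shows "(\<integral>s. poly q s \<partial>mu d)
    = (\<integral>s. poly q s * mu_weight d s \<partial>lborel) / (\<integral>s. mu_weight d s \<partial>lborel)"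
proof -
  have "(\<integral>s. poly q s \<partial>mu d)
      = (\<integral>s. (mu_weight d s / (\<integral>v. mu_weight d v \<partial>lborel)) *\<^sub>R poly q s \<partial>lborel)"
    unfolding mu_def
    by (rule integral_density)
       (use borel_measurable_continuous_onI[of "poly q"] in
         \<open>auto simp: continuous_on_poly mu_weight_nonneg intro!: divide_nonneg_nonneg\<close>)
  then show ?thesis by (simp add: mult_ac)
qed

lemma integrable_poly_mu:
  assumes "d \<ge> 2"
  shows "integrable (mu d) (poly q)"
proof -
  have "integrable lborel (\<lambda>s. (mu_weight d s / (\<integral>v. mu_weight d v \<partial>lborel)) *\<^sub>R poly q s)"
    using integrable_poly_mu_weight[OF assms, of q] by (simp add: mult_ac)
  then show ?thesis unfolding mu_def
    by (subst integrable_density)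
       (use borel_measurable_continuous_onI[of "poly q"] in
         \<open>auto simp: continuous_on_poly mu_weight_nonneg intro!: divide_nonneg_nonneg\<close>)
qed

lemma mu_weight_integral_pos:
  assumes "d \<ge> 2"
  shows "(\<integral>s. mu_weight d s \<partial>lborel) > 0"
  using integral_poly_mu_weight_pos[OF assms, of 1] by simp

lemma integral_poly_mu_pos:
  assumes "d \<ge> 2" "q \<noteq> 0" "\<And>s. -1 < s \<Longrightarrow> s < 1 \<Longrightarrow> poly q s \<ge> 0"
  shows "(\<integral>s. poly q s \<partial>mu d) > 0"
  unfolding integral_poly_mu[OF assms(1)]
  using integral_poly_mu_weight_pos[OF assms] mu_weight_integral_pos[OF assms(1)] by simp

lemma integral_poly_mu_plus:
  assumes "d \<ge> 2"
  shows "(\<integral>s. poly q s \<partial>mu_plus d) = (\<integral>s. poly ([:1, 1:] * q) s \<partial>mu d)"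
proof -
  have [simp]: "sets (mu d) = sets borel" by (simp add: mu_def)
  have "AE s in mu d. 0 \<le> 1 + s"
  proof -
    have "0 \<le> 1 + s" if "mu_weight d s / (\<integral>v. mu_weight d v \<partial>lborel) > 0" for s
      using that by (cases "s \<in> {-1..1}") (auto simp: mu_weight_def)
    then show ?thesis unfolding mu_def by (subst AE_density) auto
  qed
  then have "(\<integral>s. poly q s \<partial>mu_plus d) = (\<integral>s. (1 + s) *\<^sub>R poly q s \<partial>mu d)"
    unfolding mu_plus_def
    by (intro integral_density)
       (use borel_measurable_continuous_onI[of "poly q"] in
         \<open>auto simp: continuous_on_poly measurable_cong_sets[OF \<open>sets (mu d) = sets borel\<close> refl]\<close>)
  then show ?thesis by (simp add: algebra_simps)
qed

text \<open>The function \<open>s ^ j * (1 - s\<^sup>2) powr ((d - 1) / 2)\<close> vanishes at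
both ends of the interval, so its derivative integrates to zero. The case \<open>j = 0\<close> gives the
vanishing first moment, the cases \<open>j = k + 1\<close> the recursion.\<close>

lemma mu_weight_moment_recursion:
  assumes "d \<ge> 2"
  shows "real j * (\<integral>s. s ^ (j - 1) * mu_weight d s \<partial>lborel)
    = real (j + d - 1) * (\<integral>s. s ^ (j + 1) * mu_weight d s \<partial>lborel)"
proof -
  let ?a = "(real d - 3) / 2"
  let ?F = "\<lambda>s::real. s ^ j * (1 - s\<^sup>2) powr ((real d - 1) / 2)"
  let ?q = "smult (real j) (monom 1 (j - 1)) - smult (real (j + d - 1)) (monom 1 (j + 1))"
  have q: "poly ?q s = real j * s ^ (j - 1) - real (j + d - 1) * s ^ (j + 1)" for s
    by (simp add: poly_monom)
  have "((\<lambda>s. poly ?q s * (1 - s\<^sup>2) powr ?a) has_integral (?F 1 - ?F (-1))) {-1..1}"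
  proof (rule fundamental_theorem_of_calculus_interior)
    fix s :: real assume "s \<in> {-1<..<1}"
    then have b: "1 - s\<^sup>2 > 0" by (auto simp: abs_square_less_1 abs_less_iff)
    have e: "(1 - s\<^sup>2) powr ((real d - 1) / 2) = (1 - s\<^sup>2) powr ?a * (1 - s\<^sup>2)"
    proof -
      have "(1 - s\<^sup>2) powr ((real d - 1) / 2) = (1 - s\<^sup>2) powr (?a + 1)"
        by (simp add: field_simps)
      then show ?thesis using b by (simp only: powr_add powr_one)
    qed
    have e2: "(1 - s\<^sup>2) powr ((real d - 1) / 2 - 1) = (1 - s\<^sup>2) powr ?a"
      by (simp add: field_simps)
    have "(?F has_real_derivative real j * s ^ (j - 1) * (1 - s\<^sup>2) powr ((real d - 1) / 2)
        + s ^ j * ((real d - 1) / 2 * (1 - s\<^sup>2) powr ((real d - 1) / 2 - 1) * (- (2 * s)))) (at s)"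
      using b by (auto intro!: derivative_eq_intros simp: powr_diff field_simps)
    also have "real j * s ^ (j - 1) * (1 - s\<^sup>2) powr ((real d - 1) / 2)
        + s ^ j * ((real d - 1) / 2 * (1 - s\<^sup>2) powr ((real d - 1) / 2 - 1) * (- (2 * s)))
        = (1 - s\<^sup>2) powr ?a * (real j * s ^ (j - 1) * (1 - s\<^sup>2) - (real d - 1) * s ^ (j + 1))"
      unfolding e2 e by (simp add: field_simps)
    also have "real j * s ^ (j - 1) * (1 - s\<^sup>2) - (real d - 1) * s ^ (j + 1) = poly ?q s"
      unfolding q
        using assms by (cases j) (simp_all add: algebra_simps power2_eq_square of_nat_diff)
    finally show "(?F has_vector_derivative poly ?q s * (1 - s\<^sup>2) powr ?a) (at s)"
      by (simp add: has_real_derivative_iff_has_vector_derivative mult.commute)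
  next
    show "continuous_on {-1..1} ?F"
      using assms by (intro continuous_intros continuous_on_powr')
        (auto simp: abs_square_le_1 abs_le_iff)
  qed auto
  then have "((\<lambda>s. if s \<in> {-1..1} then poly ?q s * (1 - s\<^sup>2) powr ?a else 0) has_integral 0) UNIV"
    using assms by (subst has_integral_restrict_UNIV) simp
  also have "(\<lambda>s. if s \<in> {-1..1} then poly ?q s * (1 - s\<^sup>2) powr ?a else 0)
      = (\<lambda>s. poly ?q s * mu_weight d s)"
    by (auto simp: fun_eq_iff mu_weight_def)
  finally have "(\<integral>s. poly ?q s * mu_weight d s \<partial>lborel) = 0"
    using has_integral_integral_real[OF integrable_poly_mu_weight[OF assms, of ?q]]
    by (rule has_integral_unique[rotated])
  moreover have int: "integrable lborel (\<lambda>s. s ^ i * mu_weight d s)" for i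
    using integrable_poly_mu_weight[OF assms, of "monom 1 i"] by (simp add: poly_monom)
  have "(\<integral>s. poly ?q s * mu_weight d s \<partial>lborel)
      = (\<integral>s. real j * (s ^ (j - 1) * mu_weight d s) - real (j + d - 1) * (s ^ (j + 1) * mu_weight d s) \<partial>lborel)"
    unfolding q by (rule Bochner_Integration.integral_cong) (simp_all add: algebra_simps)
  also have "\<dots> = real j * (\<integral>s. s ^ (j - 1) * mu_weight d s \<partial>lborel)
      - real (j + d - 1) * (\<integral>s. s ^ (j + 1) * mu_weight d s \<partial>lborel)"
    using int by (subst Bochner_Integration.integral_diff) (auto simp del: power_Suc)
  ultimately show ?thesis by simp
qed

text \<open>These values determine all moments. They are compared below with the corresponding moments of the
sphere measure.\<close>

lemma mu_moments:
  assumes "d \<ge> 2"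
  shows "(\<integral>s. s ^ 0 \<partial>mu d) = 1" "(\<integral>s. s ^ 1 \<partial>mu d) = 0"
    "(\<integral>s. s ^ (k + 2) \<partial>mu d) = real (k + 1) / real (k + d) * (\<integral>s. s ^ k \<partial>mu d)"
proof -
  have eq: "(\<integral>s. s ^ i \<partial>mu d)
    = (\<integral>s. s ^ i * mu_weight d s \<partial>lborel) / (\<integral>s. mu_weight d s \<partial>lborel)" for i
    using integral_poly_mu[OF assms, of "monom 1 i"] by (simp add: poly_monom)
  show "(\<integral>s. s ^ 0 \<partial>mu d) = 1" unfolding eq using mu_weight_integral_pos[OF assms] by simp
  show "(\<integral>s. s ^ 1 \<partial>mu d) = 0"
    unfolding eq using mu_weight_moment_recursion[OF assms, of 0] assms by simp
  show "(\<integral>s. s ^ (k + 2) \<partial>mu d) = real (k + 1) / real (k + d) * (\<integral>s. s ^ k \<partial>mu d)"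
  proof -
    have "real (k + 1) * (\<integral>s. s ^ k * mu_weight d s \<partial>lborel)
        = real (k + d) * (\<integral>s. s ^ (k + 2) * mu_weight d s \<partial>lborel)"
      using mu_weight_moment_recursion[OF assms, of "k + 1"] by simp
    then show ?thesis
      unfolding eq
        using assms by (simp add: nonzero_eq_divide_eq nonzero_divide_eq_eq mult.commute del: of_nat_add power_add_numeral)
  qed
qed

section \<open>The sphere measure in polar coordinates\<close>

lemma ball_measurable [measurable]: "ball c r \<in> sets (borel :: 'a::euclidean_space measure)"
  by simp

text \<open>The factor \<open>d\<close> in the surface measure cancels in the normalization: the direction of a uniform
random point of the ball is uniform on the sphere.\<close>

lemma sphere_prob_eq_distr:
  "(sphere_prob :: 'a::euclidean_space measure) = distr (uniform_measure lborel (ball 0 1)) borel sgn"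
proof (rule measure_eqI)
  show "sets (sphere_prob :: 'a measure) = sets (distr (uniform_measure lborel (ball 0 1)) borel sgn)"
    by (simp add: sphere_prob_def sphere_surface_def)
next
  fix A :: "'a set" assume "A \<in> sets sphere_prob"
  then have A: "A \<in> sets borel" by (simp add: sphere_prob_def sphere_surface_def)
  let ?d = "ennreal (real DIM('a))" and ?v = "emeasure lborel (ball (0::'a) 1)"
  have sgn_m: "sgn \<in> borel_measurable (borel :: 'a measure)"
    unfolding sgn_div_norm[abs_def] by measurable
  have surf: "emeasure (sphere_surface :: 'a measure) B
      = ?d * emeasure lborel (ball 0 1 \<inter> sgn -` B)" if B: "B \<in> sets borel" for B
  proof -
    have "sgn -` B \<inter> space borel \<in> sets (borel :: 'a measure)" by (rule measurable_sets[OF sgn_m B])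
    have "emeasure (sphere_surface :: 'a measure) B
      = ?d * emeasure (restrict_space lborel (ball 0 1)) (sgn -` B \<inter> space (restrict_space lborel (ball (0::'a) 1)))"
      unfolding sphere_surface_def emeasure_scale_measure using sgn_m
      by (subst emeasure_distr[OF _ B]) (auto intro: measurable_restrict_space1 simp: ennreal_of_nat_eq_real_of_nat)
    also have "sgn -` B \<inter> space (restrict_space lborel (ball (0::'a) 1)) = ball 0 1 \<inter> sgn -` B"
      by (auto simp: space_restrict_space)
    also have "emeasure (restrict_space lborel (ball 0 1)) (ball 0 1 \<inter> sgn -` B)
        = emeasure lborel (ball (0::'a) 1 \<inter> sgn -` B)"
      by (rule emeasure_restrict_space) auto
    finally show ?thesis .
  qed
  have "emeasure (sphere_surface :: 'a measure) UNIV = ?d * ?v" using surf[of UNIV] by simp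
  have vfin: "?v < \<infinity>" by (rule emeasure_lborel_ball_finite)
  then have "?v = ennreal (measure lborel (ball (0::'a) 1))"
    by (intro emeasure_eq_ennreal_measure) auto
  then have vpos: "?v > 0" using content_ball_pos[of 1 "0::'a"] by simp
  have "emeasure (sphere_prob :: 'a measure) A
      = emeasure (sphere_surface :: 'a measure) A / emeasure (sphere_surface :: 'a measure) UNIV"
    unfolding sphere_prob_def using A
    by (subst emeasure_uniform_measure) (auto simp: sphere_surface_def)
  also have "\<dots> = (?d * emeasure lborel (ball 0 1 \<inter> sgn -` A)) / (?d * ?v)"
    using surf[OF A] surf[of UNIV] by simp
  also have "\<dots> = emeasure lborel (ball 0 1 \<inter> sgn -` A) / ?v"
  proof -
    have "emeasure lborel (ball (0::'a) 1 \<inter> sgn -` A) \<le> ?v"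
      by (rule emeasure_mono) auto
    then have "emeasure lborel (ball (0::'a) 1 \<inter> sgn -` A) < \<infinity>"
      using vfin by (rule order.strict_trans1)
    then obtain a where a: "a \<ge> 0" "emeasure lborel (ball (0::'a) 1 \<inter> sgn -` A) = ennreal a"
      by (cases "emeasure lborel (ball (0::'a) 1 \<inter> sgn -` A)") auto
    obtain v where v: "v > 0" "?v = ennreal v"
      using vpos vfin by (cases ?v) (auto simp: ennreal_less_zero_iff)
    show ?thesis unfolding a(2) v(2) using a(1) v(1)
      by (simp add: ennreal_mult[symmetric] divide_ennreal del: ennreal_mult)
  qed
  also have "\<dots> = emeasure (distr (uniform_measure lborel (ball 0 1)) borel sgn) A"
  proof -
    have "sgn -` A \<in> sets (lborel :: 'a measure)"
      using measurable_sets[OF sgn_m A] by simp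
    then show ?thesis
      using A sgn_m by (subst emeasure_distr) (auto simp: Int_commute)
  qed
  finally show "emeasure (sphere_prob :: 'a measure) A
    = emeasure (distr (uniform_measure lborel (ball 0 1)) borel sgn) A" .
qed

lemma nn_integral_homogeneous_ball:
  fixes f :: "'a::euclidean_space \<Rightarrow> ennreal"
  assumes [measurable]: "f \<in> borel_measurable borel"
    and hom: "\<And>a x. a > 0 \<Longrightarrow> f (a *\<^sub>R x) = f x" and r: "r > 0"
  shows "(\<integral>\<^sup>+x. f x * indicator (ball 0 r) x \<partial>lborel)
    = ennreal (r ^ DIM('a)) * (\<integral>\<^sup>+x. f x * indicator (ball 0 1) x \<partial>lborel)"
proof -
  define F where "F = (\<lambda>x. f x * indicator (ball 0 r) x)"
  have [measurable]: "F \<in> borel_measurable borel" unfolding F_def by measurable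
  have "(\<integral>\<^sup>+x. F x \<partial>lborel) = (\<integral>\<^sup>+x. ennreal (r ^ DIM('a)) * F (r *\<^sub>R x) \<partial>lborel)"
    using r
      by (subst lborel_affine[of r "0::'a"]) (simp_all add: nn_integral_density nn_integral_distr)
  also have "\<dots> = (\<integral>\<^sup>+x. ennreal (r ^ DIM('a)) * (f x * indicator (ball 0 1) x) \<partial>lborel)"
    using r by (intro nn_integral_cong) (auto simp: hom indicator_def F_def)
  finally show ?thesis by (simp add: nn_integral_cmult F_def)
qed

text \<open>For a function constant on open rays, the image of \<open>f dx\<close> under the norm and the radial density
\<open>C d r\<^bsup>d-1\<^esup> dr\<close> give the same mass to every half-line \<open>{..<r}\<close>, by scaling. These
half-lines generate the Borel sets.\<close>

lemma nn_integral_polar: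
  fixes f :: "'a::euclidean_space \<Rightarrow> ennreal" and g :: "real \<Rightarrow> ennreal"
  assumes [measurable]: "f \<in> borel_measurable borel" "g \<in> borel_measurable borel"
    and hom: "\<And>a x. a > 0 \<Longrightarrow> f (a *\<^sub>R x) = f x"
    and fin: "(\<integral>\<^sup>+x. f x * indicator (ball 0 1) x \<partial>lborel) = ennreal C" and C: "C \<ge> 0"
  shows "(\<integral>\<^sup>+x. f x * g (norm x) \<partial>lborel)
    = (\<integral>\<^sup>+r. ennreal (indicator {0..} r * (C * (real DIM('a) * r ^ (DIM('a) - 1)))) * g r \<partial>lborel)"
proof -
  let ?n = "DIM('a)"
  let ?w = "\<lambda>r. indicator {0..} r * (C * (real ?n * r ^ (?n - 1)))"
  let ?M = "distr (density lborel f) borel norm" and ?N = "density lborel (\<lambda>r. ennreal (?w r))"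
  have n: "?n > 0" by simp
  have M_ball: "emeasure ?M {..<r} = (\<integral>\<^sup>+x. f x * indicator (ball 0 r) x \<partial>lborel)" for r
  proof -
    have "emeasure ?M {..<r} = emeasure (density lborel f) (ball 0 r)"
      by (subst emeasure_distr) (auto intro!: arg_cong2[where f = emeasure])
    then show ?thesis by (simp add: emeasure_density)
  qed
  have eq: "emeasure ?M {..<r} = ennreal (if r \<le> 0 then 0 else C * r ^ ?n)" for r
  proof (cases "r \<le> 0")
    case True
    then show ?thesis unfolding M_ball by (simp add: ball_empty)
  next
    case False
    then show ?thesis unfolding M_ball using nn_integral_homogeneous_ball[of f r] hom fin C
      by (simp add: ennreal_mult[symmetric] mult.commute)
  qed
  have eq': "emeasure ?N {..<r} = ennreal (if r \<le> 0 then 0 else C * r ^ ?n)" for r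
  proof -
    have "emeasure ?N {..<r} = (\<integral>\<^sup>+s. ennreal (?w s) * indicator {..<r} s \<partial>lborel)"
      by (simp add: emeasure_density)
    also have "\<dots> = (\<integral>\<^sup>+s. ennreal (C * (real ?n * s ^ (?n - 1))) * indicator {0..max 0 r} s \<partial>lborel)"
    proof (rule nn_integral_cong_AE)
      show "AE s in lborel. ennreal (?w s) * indicator {..<r} s
          = ennreal (C * (real ?n * s ^ (?n - 1))) * indicator {0..max 0 r} s"
        using AE_lborel_singleton[of r] AE_lborel_singleton[of "0::real"]
        by eventually_elim (auto simp: indicator_def max_def)
    qed
    also have "\<dots> = C * (max 0 r) ^ ?n - C * 0 ^ ?n"
    proof (rule nn_integral_FTC_Icc)
      fix x :: real
      show "((\<lambda>s. C * s ^ ?n) has_real_derivative C * (real ?n * x ^ (?n - 1))) (at x)"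
        by (auto intro!: derivative_eq_intros)
    qed (use C in auto)
    also have "\<dots> = (if r \<le> 0 then 0 else C * r ^ ?n)" using n by (simp add: max_def power_0_left)
    finally show ?thesis .
  qed
  have "?M = ?N"
  proof (rule measure_eqI_generator_eq)
    show "Int_stable (range (lessThan :: real \<Rightarrow> real set))"
    proof -
      have "{..<a} \<inter> {..<b} = {..<min a b}" for a b :: real by auto
      then show ?thesis by (auto simp: Int_stable_def)
    qed
    show "range (lessThan :: real \<Rightarrow> real set) \<subseteq> Pow UNIV" by simp
    show "emeasure ?M X = emeasure ?N X" if "X \<in> range lessThan" for X
      using that eq eq' by auto
    have b: "sets borel = sigma_sets UNIV (range (lessThan :: real \<Rightarrow> real set))"
      by (simp add: borel_Iio)
    show "sets ?M = sigma_sets UNIV (range lessThan)" "sets ?N = sigma_sets UNIV (range lessThan)"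
      using b by simp_all
    show "range (\<lambda>i::nat. {..<real i}) \<subseteq> range lessThan" by auto
    show "(\<Union>i::nat. {..<real i}) = UNIV" using reals_Archimedean2 by auto
    show "emeasure ?M {..<real i} \<noteq> \<infinity>" for i :: nat unfolding eq by simp
  qed
  have "(\<integral>\<^sup>+x. f x * g (norm x) \<partial>lborel) = (\<integral>\<^sup>+r. g r \<partial>?M)"
    by (simp add: nn_integral_distr nn_integral_density)
  also have "\<dots> = (\<integral>\<^sup>+r. g r \<partial>?N)" using \<open>?M = ?N\<close> by simp
  also have "\<dots> = (\<integral>\<^sup>+r. ennreal (?w r) * g r \<partial>lborel)"
    by (simp add: nn_integral_density)
  finally show ?thesis .
qed

section \<open>Gaussian integrals\<close>

definition gauss_moment :: "nat \<Rightarrow> real" where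
  "gauss_moment k = (\<integral>r. indicator {0..} r * (exp (- r\<^sup>2) * r ^ k) \<partial>lborel)"

lemma has_bochner_gauss_moment:
  "has_bochner_integral lborel (\<lambda>r. indicator {0..} r * (exp (- r\<^sup>2) * r ^ k)) (gauss_moment k)"
proof (cases "even k")
  case True
  then obtain j where "k = 2 * j" by (rule evenE)
  then have "has_bochner_integral lborel (\<lambda>r. indicator {0..} r * (exp (- r\<^sup>2) * r ^ k))
      ((sqrt pi / 2) * (fact (2 * j) / (2 ^ (2 * j) * fact j)))"
    using gaussian_moment_even_pos[of j] by simp
  then show ?thesis unfolding gauss_moment_def by (simp add: has_bochner_integral_iff)
next
  case False
  then obtain j where "k = 2 * j + 1" by (rule oddE)
  then have "has_bochner_integral lborel (\<lambda>r. indicator {0..} r * (exp (- r\<^sup>2) * r ^ k))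
      (fact j / 2 :: real)"
    using gaussian_moment_odd_pos[of j] by simp
  then show ?thesis unfolding gauss_moment_def by (simp add: has_bochner_integral_iff)
qed

lemma gauss_moment_even: "gauss_moment (2 * j) = (sqrt pi / 2) * (fact (2 * j) / (2 ^ (2 * j) * fact j))"
  using has_bochner_integral_integral_eq[OF gaussian_moment_even_pos[of j]]
  by (simp add: gauss_moment_def)

lemma gauss_moment_odd: "gauss_moment (2 * j + 1) = fact j / 2"
  using has_bochner_integral_integral_eq[OF gaussian_moment_odd_pos[of j]]
  by (simp add: gauss_moment_def)

lemma gauss_moment_pos: "gauss_moment k > 0"
proof (cases "even k")
  case True
  then obtain j where "k = 2 * j" by (rule evenE)
  then show ?thesis by (simp add: gauss_moment_even)
next
  case False
  then obtain j where "k = 2 * j + 1" by (rule oddE)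
  then show ?thesis by (simp only: gauss_moment_odd) simp
qed

text \<open>This is integration by parts, read off here from the closed forms for the two parities.\<close>

lemma gauss_moment_recursion: "gauss_moment (k + 2) = real (k + 1) / 2 * gauss_moment k"
proof (cases "even k")
  case True
  then obtain j where k: "k = 2 * j" by (rule evenE)
  have "k + 2 = 2 * Suc j" using k by simp
  have cancel: "P * ((2 * y) * z * A / (4 * B * (y * D))) = z / 2 * (P * (A / (B * D)))"
    if "B \<noteq> 0" "D \<noteq> 0" "y \<noteq> 0" for P y z A B D :: real
    using that by (simp add: field_simps)
  have "fact (2 * Suc j) = (2 * real (Suc j)) * real (2 * j + 1) * fact (2 * j)"
    by (simp add: algebra_simps)
  moreover have "(2::real) ^ (2 * Suc j) = 4 * 2 ^ (2 * j)" by simp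
  moreover have "fact (Suc j) = real (Suc j) * fact j" by simp
  ultimately have "gauss_moment (2 * Suc j) = real (2 * j + 1) / 2 * gauss_moment (2 * j)"
    unfolding gauss_moment_even
    using cancel[of "2 ^ (2 * j)" "fact j" "real (Suc j)" "sqrt pi / 2" "real (2 * j + 1)" "fact (2 * j)"]
    by (simp only: power_not_zero fact_nonzero of_nat_neq_0 not_False_eq_True)
  then show ?thesis unfolding \<open>k + 2 = 2 * Suc j\<close> by (simp only: k)
next
  case False
  then obtain j where k: "k = 2 * j + 1" by (rule oddE)
  have "k + 2 = 2 * Suc j + 1" using k by simp
  then show ?thesis by (simp only: gauss_moment_odd k) (simp add: field_simps)
qed

text \<open>Under a product of identical centered normal distributions the coordinates are independent, so a
linear form with unit coefficient vector is again normal with the same variance. This supplies the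
rotation invariance that makes the moments of \<open>u \<bullet> e\<close> independent of \<open>e\<close>.\<close>

lemma nn_integral_gauss_linear_form:
  fixes e :: "'a::euclidean_space" and F :: "real \<Rightarrow> ennreal"
  assumes e: "norm e = 1" and [measurable]: "F \<in> borel_measurable borel" and \<sigma>: "\<sigma> > 0"
  shows "(\<integral>\<^sup>+x. (\<Prod>b\<in>Basis. normal_density 0 \<sigma> (x \<bullet> b)) * F (x \<bullet> e) \<partial>lborel)
    = (\<integral>\<^sup>+s. normal_density 0 \<sigma> s * F s \<partial>lborel)"
proof -
  let ?\<phi> = "normal_density 0 \<sigma>"
  define G where "G = density lborel (\<lambda>x::'a. ennreal (\<Prod>b\<in>Basis. ?\<phi> (x \<bullet> b)))"
  have sets_G [measurable_cong]: "sets G = sets borel" by (simp add: G_def)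
  have space_G [simp]: "space G = UNIV" by (simp add: G_def)
  have rect: "emeasure G {x. \<forall>b\<in>Basis. x \<bullet> b \<in> A b} = (\<Prod>b\<in>Basis. emeasure (density lborel ?\<phi>) (A b))"
    if [measurable]: "\<And>b. b \<in> Basis \<Longrightarrow> A b \<in> sets borel" for A :: "'a \<Rightarrow> real set"
  proof -
    have m: "{x. \<forall>b\<in>Basis. x \<bullet> b \<in> A b} \<in> sets borel"
    proof -
      have "{x::'a. \<forall>b\<in>Basis. x \<bullet> b \<in> A b} = (\<Inter>b\<in>Basis. (\<lambda>x. x \<bullet> b) -` A b \<inter> space borel)" by auto
      also have "\<dots> \<in> sets borel"
        by (intro sets.finite_INT measurable_sets[where A = borel]) (auto intro: that)
      finally show ?thesis .
    qed
    have "emeasure G {x. \<forall>b\<in>Basis. x \<bullet> b \<in> A b}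
      = (\<integral>\<^sup>+x. ennreal (\<Prod>b\<in>Basis. ?\<phi> (x \<bullet> b)) * indicator {x. \<forall>b\<in>Basis. x \<bullet> b \<in> A b} x \<partial>lborel)"
      unfolding G_def using m by (subst emeasure_density) auto
    also have "\<dots> = (\<integral>\<^sup>+x. (\<Prod>b\<in>Basis. ennreal (?\<phi> (x \<bullet> b)) * indicator (A b) (x \<bullet> b)) \<partial>lborel)"
    proof (rule nn_integral_cong)
      fix x :: 'a
      have "indicator {x. \<forall>b\<in>Basis. x \<bullet> b \<in> A b} x = (\<Prod>b\<in>Basis. indicator (A b) (x \<bullet> b) :: ennreal)"
        by (auto simp: indicator_def prod.neutral intro!: prod_zero[symmetric])
      then show "ennreal (\<Prod>b\<in>Basis. ?\<phi> (x \<bullet> b)) * indicator {x. \<forall>b\<in>Basis. x \<bullet> b \<in> A b} x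
        = (\<Prod>b\<in>Basis. ennreal (?\<phi> (x \<bullet> b)) * indicator (A b) (x \<bullet> b))"
        by (simp add: prod.distrib prod_ennreal)
    qed
    also have "\<dots> = (\<Prod>b\<in>Basis. \<integral>\<^sup>+s. ennreal (?\<phi> s) * indicator (A b) s \<partial>lborel)"
      by (rule nn_integral_lborel_prod[where f = "\<lambda>b s. ennreal (?\<phi> s) * indicator (A b) s"]) auto
    also have "\<dots> = (\<Prod>b\<in>Basis. emeasure (density lborel ?\<phi>) (A b))"
      by (intro prod.cong refl) (simp add: emeasure_density)
    finally show ?thesis .
  qed
  interpret N: prob_space "density lborel (\<lambda>s. ennreal (?\<phi> s))"
    by (rule prob_space_normal_density[OF \<sigma>])
  have prob: "prob_space G"
    using rect[of "\<lambda>_. UNIV"] N.emeasure_space_1 by (intro prob_spaceI) simp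
  interpret G: prob_space G by (rule prob)
  have marg: "distr G borel (\<lambda>x. x \<bullet> b) = density lborel (\<lambda>s. ennreal (?\<phi> s))" if b: "b \<in> Basis" for b
  proof (rule measure_eqI)
    fix A :: "real set" assume "A \<in> sets (distr G borel (\<lambda>x. x \<bullet> b))"
    then have A: "A \<in> sets borel" by simp
    have "emeasure (distr G borel (\<lambda>x. x \<bullet> b)) A = emeasure G {x. x \<bullet> b \<in> A}"
      using A by (subst emeasure_distr) (auto simp: vimage_def)
    also have "{x. x \<bullet> b \<in> A} = {x. \<forall>i\<in>Basis. x \<bullet> i \<in> (if i = b then A else UNIV)}"
      using b by auto
    also have "emeasure G \<dots> = (\<Prod>i\<in>Basis. emeasure (density lborel ?\<phi>) (if i = b then A else UNIV))"
      using A by (intro rect) auto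
    also have "\<dots> = (\<Prod>i\<in>Basis. if i = b then emeasure (density lborel ?\<phi>) A else 1)"
      using N.emeasure_space_1 by (intro prod.cong) auto
    also have "\<dots> = emeasure (density lborel ?\<phi>) A" using b by simp
    finally show "emeasure (distr G borel (\<lambda>x. x \<bullet> b)) A = emeasure (density lborel ?\<phi>) A" .
  qed simp
  have indep: "G.indep_vars (\<lambda>_. borel) (\<lambda>b x. x \<bullet> b) Basis"
  proof (subst G.indep_vars_iff_distr_eq_PiM')
    interpret PF: product_sigma_finite "\<lambda>b::'a. distr G borel (\<lambda>x. x \<bullet> b)"
      by (intro product_sigma_finite.intro prob_space_imp_sigma_finite G.prob_space_distr) measurable
    show "distr G (Pi\<^sub>M Basis (\<lambda>_. borel)) (\<lambda>x. \<lambda>b\<in>Basis. x \<bullet> b)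
      = Pi\<^sub>M Basis (\<lambda>b. distr G borel (\<lambda>x. x \<bullet> b))"
    proof (rule PF.PiM_eqI)
      fix A :: "'a \<Rightarrow> real set" assume "\<And>b. b \<in> Basis \<Longrightarrow> A b \<in> sets (distr G borel (\<lambda>x. x \<bullet> b))"
      then have A: "\<And>b. b \<in> Basis \<Longrightarrow> A b \<in> sets borel" by simp
      have "emeasure (distr G (Pi\<^sub>M Basis (\<lambda>_. borel)) (\<lambda>x. \<lambda>b\<in>Basis. x \<bullet> b)) (Pi\<^sub>E Basis A)
        = emeasure G {x. \<forall>b\<in>Basis. x \<bullet> b \<in> A b}"
        using A
          by (subst emeasure_distr) (auto intro!: arg_cong2[where f = emeasure] sets_PiM_I_finite)
      also have "\<dots> = (\<Prod>b\<in>Basis. emeasure (density lborel ?\<phi>) (A b))" using A by (rule rect)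
      also have "\<dots> = (\<Prod>b\<in>Basis. emeasure (distr G borel (\<lambda>x. x \<bullet> b)) (A b))"
        by (intro prod.cong refl) (simp only: marg)
      finally show "emeasure (distr G (Pi\<^sub>M Basis (\<lambda>_. borel)) (\<lambda>x. \<lambda>b\<in>Basis. x \<bullet> b)) (Pi\<^sub>E Basis A)
        = (\<Prod>b\<in>Basis. emeasure (distr G borel (\<lambda>x. x \<bullet> b)) (A b))" .
    qed (auto cong: sets_PiM_cong)
  qed auto
  \<comment> \<open>Coordinates with coefficient zero would contribute degenerate normal distributions.\<close>
  define I where "I = {b \<in> Basis. e \<bullet> b \<noteq> 0}"
  have I: "finite I" "I \<subseteq> Basis" by (auto simp: I_def)
  have sq: "(\<Sum>b\<in>I. (e \<bullet> b)\<^sup>2) = 1"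
  proof -
    have "(\<Sum>b\<in>I. (e \<bullet> b)\<^sup>2) = (\<Sum>b\<in>Basis. (e \<bullet> b)\<^sup>2)"
      by (rule sum.mono_neutral_left) (auto simp: I_def)
    also have "\<dots> = e \<bullet> e" by (simp add: euclidean_inner[of e e] power2_eq_square)
    finally show ?thesis using e by (simp add: dot_square_norm)
  qed
  then have "I \<noteq> {}" by auto
  have "distributed G lborel (\<lambda>x. \<Sum>b\<in>I. (e \<bullet> b) * (x \<bullet> b))
      (normal_density (\<Sum>b\<in>I. 0) (sqrt (\<Sum>b\<in>I. (\<bar>e \<bullet> b\<bar> * \<sigma>)\<^sup>2)))"
  proof (rule G.sum_indep_normal[OF I(1) \<open>I \<noteq> {}\<close>])
    show "G.indep_vars (\<lambda>_. borel) (\<lambda>b x. (e \<bullet> b) * (x \<bullet> b)) I"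
      using G.indep_vars_compose2[OF G.indep_vars_subset[OF indep I(2)], of "\<lambda>b s. (e \<bullet> b) * s" "\<lambda>_. borel"]
      by simp
    show "0 < \<bar>e \<bullet> b\<bar> * \<sigma>" if "b \<in> I" for b using that \<sigma> by (simp add: I_def)
    show "distributed G lborel (\<lambda>x. (e \<bullet> b) * (x \<bullet> b)) (normal_density 0 (\<bar>e \<bullet> b\<bar> * \<sigma>))" if b: "b \<in> I" for b
    proof -
      have "distributed G lborel (\<lambda>x. x \<bullet> b) ?\<phi>"
        unfolding distributed_def using marg[of b] b I(2)
        by (auto cong: distr_cong simp: subset_iff)
      then have "distributed G lborel (\<lambda>x. 0 + (e \<bullet> b) * (x \<bullet> b)) (normal_density (0 + (e \<bullet> b) * 0) (\<bar>e \<bullet> b\<bar> * \<sigma>))"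
        using b \<sigma> by (intro G.normal_density_affine) (auto simp: I_def)
      then show ?thesis by simp
    qed
  qed
  moreover have "(\<Sum>b\<in>I. (e \<bullet> b) * (x \<bullet> b)) = x \<bullet> e" for x
  proof -
    have "(\<Sum>b\<in>I. (e \<bullet> b) * (x \<bullet> b)) = (\<Sum>b\<in>Basis. (e \<bullet> b) * (x \<bullet> b))"
      by (rule sum.mono_neutral_left) (auto simp: I_def)
    then show ?thesis by (simp add: euclidean_inner[of x e] mult.commute)
  qed
  moreover have "sqrt (\<Sum>b\<in>I. (\<bar>e \<bullet> b\<bar> * \<sigma>)\<^sup>2) = \<sigma>"
    using sq \<sigma> by (simp add: power_mult_distrib sum_distrib_right[symmetric])
  ultimately have D: "distributed G lborel (\<lambda>x. x \<bullet> e) ?\<phi>" by simp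
  have "(\<integral>\<^sup>+s. ?\<phi> s * F s \<partial>lborel) = (\<integral>\<^sup>+x. F (x \<bullet> e) \<partial>G)"
    by (rule distributed_nn_integral[OF D]) simp
  also have "\<dots> = (\<integral>\<^sup>+x. (\<Prod>b\<in>Basis. ?\<phi> (x \<bullet> b)) * F (x \<bullet> e) \<partial>lborel)"
    unfolding G_def by (subst nn_integral_density) auto
  finally show ?thesis by simp
qed


section \<open>Moments of the sphere measure\<close>

lemma nn_integral_of_has_bochner_integral:
  fixes f :: "'a \<Rightarrow> real"
  assumes "has_bochner_integral M f I" "\<And>x. 0 \<le> f x"
  shows "(\<integral>\<^sup>+x. ennreal (f x) \<partial>M) = ennreal I"
  using assms nn_integral_eq_integral[of M f] by (simp add: has_bochner_integral_iff)

lemma inner_sgn_power_bound: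
  assumes "norm e = 1"
  shows "\<bar>(sgn x \<bullet> e) ^ k\<bar> \<le> (1::real)"
proof -
  have "\<bar>sgn x \<bullet> e\<bar> \<le> norm (sgn x) * norm e" by (rule Cauchy_Schwarz_ineq2)
  also have "\<dots> \<le> 1" using assms by (simp add: norm_sgn)
  finally show ?thesis by (simp add: power_abs power_le_one)
qed

text \<open>Up to the volume of the ball this is the moment of \<open>u \<bullet> e\<close> under the sphere measure.\<close>

definition cone_moment :: "'a::euclidean_space \<Rightarrow> nat \<Rightarrow> real" where
  "cone_moment e k = (\<integral>x. (sgn x \<bullet> e) ^ k * indicator (ball 0 1) x \<partial>lborel)"

lemma sgn_measurable [measurable]: "sgn \<in> borel_measurable (borel :: 'a::euclidean_space measure)"
  unfolding sgn_div_norm[abs_def] by measurable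

lemma integrable_cone:
  fixes e :: "'a::euclidean_space"
  assumes "norm e = 1"
  shows "integrable lborel (\<lambda>x. (sgn x \<bullet> e) ^ k * indicator (ball 0 1) x)"
proof (rule Bochner_Integration.integrable_bound)
  show "integrable lborel (indicator (ball (0::'a) 1) :: 'a \<Rightarrow> real)"
    using emeasure_lborel_ball_finite by (intro integrable_real_indicator) auto
  show "AE x in lborel. norm ((sgn x \<bullet> e) ^ k * indicator (ball 0 1) x)
      \<le> norm (indicator (ball (0::'a) 1) x :: real)"
    using inner_sgn_power_bound[OF assms] by (intro AE_I2) (simp add: indicator_def abs_mult)
qed measurable

lemma cone_moment_odd:
  fixes e :: "'a::euclidean_space"
  assumes "odd k"
  shows "cone_moment e k = 0"
proof -
  define F where "F = (\<lambda>x::'a. (sgn x \<bullet> e) ^ k * indicator (ball 0 1) x :: real)"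
  have [measurable]: "F \<in> borel_measurable borel" unfolding F_def by measurable
  have "(\<integral>x. F x \<partial>lborel) = (\<integral>x. F (- x) \<partial>lborel)"
    by (subst lborel_affine[of "-1" "0::'a"]) (simp_all add: density_1 integral_distr)
  also have "(\<lambda>x. F (- x)) = (\<lambda>x. - F x)"
    using assms by (auto simp: F_def sgn_minus indicator_def fun_eq_iff)
  finally show ?thesis by (simp add: F_def cone_moment_def)
qed

text \<open>Both sides evaluate the integral of \<open>(x \<bullet> e)\<^sup>k exp (- |x|\<^sup>2)\<close>, up to the constant
\<open>(1 / sqrt \<pi>)\<^sup>d\<close>: the left-hand side in polar coordinates, the right-hand side by the
one-dimensional distribution of the linear form. For even \<open>k\<close> all integrands are nonnegative.\<close>

lemma cone_moment_even:
  fixes e :: "'a::euclidean_space"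
  assumes e: "norm e = 1" and k: "even k"
  shows "(1 / sqrt pi) ^ DIM('a) * (cone_moment e k * (real DIM('a) * gauss_moment (DIM('a) - 1 + k)))
    = 2 / sqrt pi * gauss_moment k"
proof -
  let ?n = "DIM('a)" and ?C = "cone_moment e k"
  \<comment> \<open>With this deviation the normal density is a multiple of \<open>exp (- s\<^sup>2)\<close>.\<close>
  let ?\<sigma> = "sqrt (1/2)"
  have C0: "?C \<ge> 0" unfolding cone_moment_def
    using k by (intro integral_nonneg_AE AE_I2 mult_nonneg_nonneg) (auto simp: zero_le_even_power)
  have nd: "normal_density 0 ?\<sigma> s = 1 / sqrt pi * exp (- s\<^sup>2)" for s
    by (simp add: normal_density_def)
  have prod: "(\<Prod>b\<in>Basis. normal_density 0 ?\<sigma> (x \<bullet> b)) = (1 / sqrt pi) ^ ?n * exp (- (norm x)\<^sup>2)" for x :: 'a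
  proof -
    have "(\<Prod>b\<in>Basis. exp (- (x \<bullet> b)\<^sup>2)) = exp (\<Sum>b\<in>Basis. - (x \<bullet> b)\<^sup>2)"
      by (simp add: exp_sum)
    also have "(\<Sum>b\<in>Basis. - (x \<bullet> b)\<^sup>2) = - (norm x)\<^sup>2"
    proof -
      have "(norm x)\<^sup>2 = x \<bullet> x" by (rule power2_norm_eq_inner)
      also have "\<dots> = (\<Sum>b\<in>Basis. (x \<bullet> b)\<^sup>2)"
        by (simp only: euclidean_inner[of x x] power2_eq_square)
      finally show ?thesis by (simp add: sum_negf)
    qed
    finally show ?thesis by (simp only: nd prod.distrib prod_constant)
  qed
  have "(\<integral>\<^sup>+x. ennreal ((sgn x \<bullet> e) ^ k) * indicator (ball 0 1) x \<partial>lborel)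
      = (\<integral>\<^sup>+x. ennreal ((sgn x \<bullet> e) ^ k * indicator (ball 0 1) x) \<partial>lborel)"
    by (intro nn_integral_cong) (auto simp: indicator_def)
  also have "\<dots> = ennreal ?C"
    unfolding cone_moment_def using integrable_cone[OF e] k
    by (intro nn_integral_eq_integral AE_I2 mult_nonneg_nonneg) (auto simp: zero_le_even_power)
  finally have ball: "(\<integral>\<^sup>+x. ennreal ((sgn x \<bullet> e) ^ k) * indicator (ball 0 1) x \<partial>lborel) = ennreal ?C" .
  have "(\<integral>\<^sup>+x. ennreal ((sgn x \<bullet> e) ^ k) * ennreal ((1 / sqrt pi) ^ ?n * (norm x ^ k * exp (- (norm x)\<^sup>2))) \<partial>lborel)
    = (\<integral>\<^sup>+r. ennreal (indicator {0..} r * (?C * (real ?n * r ^ (?n - 1))))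
        * ennreal ((1 / sqrt pi) ^ ?n * (r ^ k * exp (- r\<^sup>2))) \<partial>lborel)"
    using ball C0
    by (intro nn_integral_polar[where g = "\<lambda>r. ennreal ((1 / sqrt pi) ^ ?n * (r ^ k * exp (- r\<^sup>2)))"])
       (auto simp: sgn_scaleR)
  also have "\<dots> = (\<integral>\<^sup>+r. ennreal ((1 / sqrt pi) ^ ?n * (?C * real ?n))
      * ennreal (indicator {0..} r * (exp (- r\<^sup>2) * r ^ (?n - 1 + k))) \<partial>lborel)"
  proof (rule nn_integral_cong)
    fix r :: real
    show "ennreal (indicator {0..} r * (?C * (real ?n * r ^ (?n - 1))))
        * ennreal ((1 / sqrt pi) ^ ?n * (r ^ k * exp (- r\<^sup>2)))
      = ennreal ((1 / sqrt pi) ^ ?n * (?C * real ?n))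
      * ennreal (indicator {0..} r * (exp (- r\<^sup>2) * r ^ (?n - 1 + k)))"
      unfolding power_add[of r "?n - 1" k] using C0
      by (cases "r \<ge> 0") (simp_all add: ennreal_mult[symmetric] mult_ac)
  qed
  also have "\<dots> = ennreal ((1 / sqrt pi) ^ ?n * (?C * real ?n)) * ennreal (gauss_moment (?n - 1 + k))"
  proof (subst nn_integral_cmult)
    have "(\<integral>\<^sup>+r. ennreal (indicator {0..} r * (exp (- r\<^sup>2) * r ^ (?n - 1 + k))) \<partial>lborel)
        = ennreal (gauss_moment (?n - 1 + k))"
      by (intro nn_integral_of_has_bochner_integral has_bochner_gauss_moment) (simp add: indicator_def)
    then show "ennreal ((1 / sqrt pi) ^ ?n * (?C * real ?n))
        * (\<integral>\<^sup>+r. ennreal (indicator {0..} r * (exp (- r\<^sup>2) * r ^ (?n - 1 + k))) \<partial>lborel)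
      = ennreal ((1 / sqrt pi) ^ ?n * (?C * real ?n)) * ennreal (gauss_moment (?n - 1 + k))"
      by (simp only:)
  qed measurable
  finally have radial: "(\<integral>\<^sup>+x. ennreal ((sgn x \<bullet> e) ^ k) * ennreal ((1 / sqrt pi) ^ ?n * (norm x ^ k * exp (- (norm x)\<^sup>2))) \<partial>lborel)
    = ennreal ((1 / sqrt pi) ^ ?n * (?C * real ?n) * gauss_moment (?n - 1 + k))"
    using C0 gauss_moment_pos[of "?n - 1 + k"] by (simp add: ennreal_mult)
  have "(\<integral>\<^sup>+x. ennreal ((sgn x \<bullet> e) ^ k) * ennreal ((1 / sqrt pi) ^ ?n * (norm x ^ k * exp (- (norm x)\<^sup>2))) \<partial>lborel)
      = (\<integral>\<^sup>+x. ennreal (\<Prod>b\<in>Basis. normal_density 0 ?\<sigma> (x \<bullet> b)) * ennreal ((x \<bullet> e) ^ k) \<partial>lborel)"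
  proof (rule nn_integral_cong)
    fix x :: 'a
    have "(sgn x \<bullet> e) ^ k * norm x ^ k = (x \<bullet> e) ^ k"
    proof -
      have "(sgn x \<bullet> e) * norm x = x \<bullet> e" by (cases "x = 0") (simp_all add: sgn_div_norm)
      then show ?thesis by (simp only: power_mult_distrib[symmetric])
    qed
    then have "(sgn x \<bullet> e) ^ k * ((1 / sqrt pi) ^ ?n * (norm x ^ k * exp (- (norm x)\<^sup>2)))
      = (1 / sqrt pi) ^ ?n * exp (- (norm x)\<^sup>2) * (x \<bullet> e) ^ k" by (metis mult.assoc mult.commute)
    then show "ennreal ((sgn x \<bullet> e) ^ k) * ennreal ((1 / sqrt pi) ^ ?n * (norm x ^ k * exp (- (norm x)\<^sup>2)))
      = ennreal (\<Prod>b\<in>Basis. normal_density 0 ?\<sigma> (x \<bullet> b)) * ennreal ((x \<bullet> e) ^ k)"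
      unfolding prod using k by (simp add: ennreal_mult'[symmetric] zero_le_even_power)
  qed
  also have "\<dots> = (\<integral>\<^sup>+s. ennreal (normal_density 0 ?\<sigma> s) * ennreal (s ^ k) \<partial>lborel)"
    by (rule nn_integral_gauss_linear_form[OF e]) auto
  also have "\<dots> = (\<integral>\<^sup>+s. ennreal (normal_density 0 ?\<sigma> s * s ^ k) \<partial>lborel)"
    by (intro nn_integral_cong) (simp add: ennreal_mult')
  also have "\<dots> = ennreal (2 / sqrt pi * gauss_moment k)"
  proof -
    obtain j where j: "k = 2 * j" using k by (rule evenE)
    have "has_bochner_integral lborel (\<lambda>s. normal_density 0 ?\<sigma> s * s ^ k) (2 / sqrt pi * gauss_moment k)"
      using normal_moment_even[of ?\<sigma> 0 j] unfolding j gauss_moment_even by (simp add: power_mult)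
    then show ?thesis using k
      by (intro nn_integral_of_has_bochner_integral) (auto simp: zero_le_even_power)
  qed
  finally have "ennreal ((1 / sqrt pi) ^ ?n * (?C * real ?n) * gauss_moment (?n - 1 + k))
      = ennreal (2 / sqrt pi * gauss_moment k)" unfolding radial .
  then show ?thesis
    using C0 gauss_moment_pos[of "?n - 1 + k"] gauss_moment_pos[of k]
    by (subst (asm) ennreal_inj) (auto simp: mult_ac)
qed

text \<open>Dividing the identities for \<open>k + 2\<close> and \<open>k\<close>, the Gaussian half-line moments contribute the
factors \<open>(k + 1) / 2\<close> and \<open>(k + d) / 2\<close>.\<close>

lemma cone_moment_recursion:
  fixes e :: "'a::euclidean_space"
  assumes e: "norm e = 1"
  shows "cone_moment e (k + 2) = real (k + 1) / real (k + DIM('a)) * cone_moment e k"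
proof (cases "even k")
  case True
  let ?n = "DIM('a)" and ?g = gauss_moment
  have n: "?n > 0" by simp
  have pi: "(1 / sqrt pi) ^ ?n > 0" by simp
  have idx: "?n - 1 + (k + 2) = (?n - 1 + k) + 2" by simp
  have "?n - 1 + k + 1 = k + ?n" using n by linarith
  then have g1: "?g (?n - 1 + (k + 2)) = real (k + ?n) / 2 * ?g (?n - 1 + k)"
    unfolding idx using gauss_moment_recursion[of "?n - 1 + k"] by simp
  have "(1 / sqrt pi) ^ ?n * (cone_moment e (k + 2) * (real ?n * ?g (?n - 1 + (k + 2))))
      = 2 / sqrt pi * ?g (k + 2)"
    using True by (intro cone_moment_even[OF e]) simp
  also have "\<dots> = real (k + 1) / 2 * (2 / sqrt pi * ?g k)"
    unfolding gauss_moment_recursion by simp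
  also have "\<dots> = real (k + 1) / 2 * ((1 / sqrt pi) ^ ?n * (cone_moment e k * (real ?n * ?g (?n - 1 + k))))"
    using cone_moment_even[OF e True] by simp
  finally have "((1 / sqrt pi) ^ ?n * real ?n * ?g (?n - 1 + k) / 2) * (cone_moment e (k + 2) * real (k + ?n))
    = ((1 / sqrt pi) ^ ?n * real ?n * ?g (?n - 1 + k) / 2) * (real (k + 1) * cone_moment e k)"
    unfolding g1 by (simp only: mult_ac times_divide_eq_left times_divide_eq_right)
  moreover have "(1 / sqrt pi) ^ ?n * real ?n * ?g (?n - 1 + k) / 2 \<noteq> 0"
    using n gauss_moment_pos[of "?n - 1 + k"] by simp
  ultimately have "cone_moment e (k + 2) * real (k + ?n) = real (k + 1) * cone_moment e k"
    by (rule mult_left_cancel[THEN iffD1, rotated])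
  then show ?thesis using n by (simp add: field_simps del: of_nat_add)
qed (simp add: cone_moment_odd)

lemma integral_sphere_prob:
  fixes f :: "'a::euclidean_space \<Rightarrow> real"
  assumes [measurable]: "f \<in> borel_measurable borel"
  shows "(\<integral>u. f u \<partial>sphere_prob)
      = (\<integral>x. f (sgn x) * indicator (ball 0 1) x \<partial>lborel) / measure lborel (ball (0::'a) 1)"
    and "integrable sphere_prob f \<longleftrightarrow> integrable lborel (\<lambda>x. f (sgn x) * indicator (ball 0 1) x)"
proof -
  let ?v = "measure lborel (ball (0::'a) 1)"
  have v: "?v > 0" using content_ball_pos[of 1 "0::'a"] by simp
  have "emeasure lborel (ball (0::'a) 1) = ennreal ?v"
    using emeasure_lborel_ball_finite[of "0::'a" 1] by (intro emeasure_eq_ennreal_measure) auto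
  then have unif: "uniform_measure lborel (ball (0::'a) 1)
      = density lborel (\<lambda>x. ennreal (indicator (ball 0 1) x / ?v))"
    unfolding uniform_measure_def using v
    by (intro arg_cong2[where f = density] refl ext) (simp add: indicator_def divide_ennreal flip: ennreal_1)
  have "(\<integral>u. f u \<partial>sphere_prob) = (\<integral>x. f (sgn x) \<partial>uniform_measure lborel (ball 0 1))"
    unfolding sphere_prob_eq_distr by (rule integral_distr) auto
  also have "\<dots> = (\<integral>x. (indicator (ball 0 1) x / ?v) *\<^sub>R f (sgn x) \<partial>lborel)"
    unfolding unif by (rule integral_density) auto
  finally show "(\<integral>u. f u \<partial>sphere_prob)
      = (\<integral>x. f (sgn x) * indicator (ball 0 1) x \<partial>lborel) / ?v" by (simp add: mult_ac)
  have "integrable sphere_prob f \<longleftrightarrow> integrable (uniform_measure lborel (ball 0 1)) (\<lambda>x. f (sgn x))"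
    unfolding sphere_prob_eq_distr by (rule integrable_distr_eq) auto
  also have "\<dots> \<longleftrightarrow> integrable lborel (\<lambda>x. (indicator (ball 0 1) x / ?v) *\<^sub>R f (sgn x))"
    unfolding unif by (rule integrable_density) auto
  also have "\<dots> \<longleftrightarrow> integrable lborel (\<lambda>x. (f (sgn x) * indicator (ball 0 1) x) / ?v)"
    by (simp add: mult_ac)
  finally show "integrable sphere_prob f \<longleftrightarrow> integrable lborel (\<lambda>x. f (sgn x) * indicator (ball 0 1) x)"
    using v by (simp only: divide_inverse integrable_mult_left_iff) simp
qed

lemma sphere_moments:
  fixes e :: "'a::euclidean_space"
  assumes e: "norm e = 1"
  shows "integrable sphere_prob (\<lambda>u. (u \<bullet> e) ^ k)"
    and "(\<integral>u. (u \<bullet> e) ^ 0 \<partial>sphere_prob) = 1" "(\<integral>u. (u \<bullet> e) ^ 1 \<partial>sphere_prob) = 0"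
    and "(\<integral>u. (u \<bullet> e) ^ (k + 2) \<partial>sphere_prob)
      = real (k + 1) / real (k + DIM('a)) * (\<integral>u. (u \<bullet> e) ^ k \<partial>sphere_prob)"
proof -
  have eq: "(\<integral>u. (u \<bullet> e) ^ k \<partial>sphere_prob) = cone_moment e k / measure lborel (ball (0::'a) 1)" for k
    unfolding cone_moment_def by (rule integral_sphere_prob) measurable
  show "integrable sphere_prob (\<lambda>u. (u \<bullet> e) ^ k)"
    using integrable_cone[OF e, of k] by (subst integral_sphere_prob) auto
  show "(\<integral>u. (u \<bullet> e) ^ 0 \<partial>sphere_prob) = 1"
    unfolding eq using content_ball_pos[of 1 "0::'a"] by (simp add: cone_moment_def)
  show "(\<integral>u. (u \<bullet> e) ^ 1 \<partial>sphere_prob) = 0" unfolding eq by (simp add: cone_moment_odd)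
  show "(\<integral>u. (u \<bullet> e) ^ (k + 2) \<partial>sphere_prob)
      = real (k + 1) / real (k + DIM('a)) * (\<integral>u. (u \<bullet> e) ^ k \<partial>sphere_prob)"
    unfolding eq using cone_moment_recursion[OF e, of k] by simp
qed

section \<open>Zonal polynomials and designs\<close>

lemma poly_fun_deg_le_mono:
  assumes "poly_fun_deg_le k p" "k \<le> t"
  shows "poly_fun_deg_le t p"
proof -
  obtain A c where A: "finite A" "\<forall>\<alpha>\<in>A. (\<Sum>b\<in>Basis. \<alpha> b) \<le> k"
      "p = (\<lambda>x. \<Sum>\<alpha>\<in>A. c \<alpha> * (\<Prod>b\<in>Basis. (x \<bullet> b) ^ \<alpha> b))"
    using assms(1) unfolding poly_fun_deg_le_def by blast
  moreover have "\<forall>\<alpha>\<in>A. (\<Sum>b\<in>Basis. \<alpha> b) \<le> t" using A(2) assms(2) order_trans by blast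
  ultimately show ?thesis unfolding poly_fun_deg_le_def by blast
qed

lemma poly_fun_deg_le_add:
  fixes p q :: "'a::euclidean_space \<Rightarrow> real"
  assumes "poly_fun_deg_le t p" "poly_fun_deg_le t q"
  shows "poly_fun_deg_le t (\<lambda>x. p x + q x)"
proof -
  let ?m = "\<lambda>(x::'a) \<alpha>. \<Prod>b\<in>Basis. (x \<bullet> b) ^ \<alpha> b"
  obtain A :: "('a \<Rightarrow> nat) set" and a where A: "finite A" "\<forall>\<alpha>\<in>A. (\<Sum>b\<in>Basis. \<alpha> b) \<le> t"
      "p = (\<lambda>x. \<Sum>\<alpha>\<in>A. a \<alpha> * ?m x \<alpha>)"
    using assms(1) unfolding poly_fun_deg_le_def by blast
  obtain B :: "('a \<Rightarrow> nat) set" and b where B: "finite B" "\<forall>\<alpha>\<in>B. (\<Sum>b\<in>Basis. \<alpha> b) \<le> t"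
      "q = (\<lambda>x. \<Sum>\<alpha>\<in>B. b \<alpha> * ?m x \<alpha>)"
    using assms(2) unfolding poly_fun_deg_le_def by blast
  define c where "c = (\<lambda>\<alpha>. (if \<alpha> \<in> A then a \<alpha> else 0) + (if \<alpha> \<in> B then b \<alpha> else 0))"
  have "p x + q x = (\<Sum>\<alpha>\<in>A \<union> B. c \<alpha> * ?m x \<alpha>)" for x
  proof -
    have "p x = (\<Sum>\<alpha>\<in>A \<union> B. (if \<alpha> \<in> A then a \<alpha> else 0) * ?m x \<alpha>)"
      unfolding A(3) using A(1) B(1) by (intro sum.mono_neutral_cong_left) auto
    moreover have "q x = (\<Sum>\<alpha>\<in>A \<union> B. (if \<alpha> \<in> B then b \<alpha> else 0) * ?m x \<alpha>)"
      unfolding B(3) using A(1) B(1) by (intro sum.mono_neutral_cong_left) auto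
    ultimately show ?thesis by (simp only: c_def distrib_right sum.distrib)
  qed
  then show ?thesis
    unfolding poly_fun_deg_le_def using A(1,2) B(1,2)
    by (intro exI[of _ "A \<union> B"] exI[of _ c]) auto
qed

lemma poly_fun_deg_le_cmul:
  assumes "poly_fun_deg_le t p"
  shows "poly_fun_deg_le t (\<lambda>x. r * p x)"
proof -
  obtain A c where A: "finite A" "\<forall>\<alpha>\<in>A. (\<Sum>b\<in>Basis. \<alpha> b) \<le> t"
      "p = (\<lambda>x. \<Sum>\<alpha>\<in>A. c \<alpha> * (\<Prod>b\<in>Basis. (x \<bullet> b) ^ \<alpha> b))"
    using assms unfolding poly_fun_deg_le_def by blast
  then show ?thesis
    unfolding poly_fun_deg_le_def
    by (intro exI[of _ A] exI[of _ "\<lambda>\<alpha>. r * c \<alpha>"]) (simp add: sum_distrib_left mult.assoc)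
qed

text \<open>Raising one exponent is injective on exponent vectors, so no coefficients have to be merged.\<close>

lemma poly_fun_deg_le_coordinate:
  fixes p :: "'a::euclidean_space \<Rightarrow> real"
  assumes "poly_fun_deg_le t p" and i: "i \<in> Basis"
  shows "poly_fun_deg_le (Suc t) (\<lambda>x. (x \<bullet> i) * p x)"
proof -
  obtain A :: "('a \<Rightarrow> nat) set" and c where A: "finite A" "\<forall>\<alpha>\<in>A. (\<Sum>b\<in>Basis. \<alpha> b) \<le> t"
      "p = (\<lambda>x. \<Sum>\<alpha>\<in>A. c \<alpha> * (\<Prod>b\<in>Basis. (x \<bullet> b) ^ \<alpha> b))"
    using assms unfolding poly_fun_deg_le_def by blast
  define up where "up = (\<lambda>\<alpha>::'a \<Rightarrow> nat. \<alpha>(i := Suc (\<alpha> i)))"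
  define down where "down = (\<lambda>\<alpha>::'a \<Rightarrow> nat. \<alpha>(i := \<alpha> i - 1))"
  have du: "down (up \<alpha>) = \<alpha>" for \<alpha> by (simp add: up_def down_def)
  have inj: "inj_on up A" by (metis du inj_onI)
  have deg: "(\<Sum>b\<in>Basis. up \<alpha> b) = Suc (\<Sum>b\<in>Basis. \<alpha> b)" for \<alpha>
    using i by (simp add: up_def sum.remove[of Basis i])
  have mon: "(\<Prod>b\<in>Basis. (x \<bullet> b) ^ up \<alpha> b) = (x \<bullet> i) * (\<Prod>b\<in>Basis. (x \<bullet> b) ^ \<alpha> b)" for x \<alpha>
    using i by (simp add: up_def prod.remove[of Basis i] mult.assoc)
  have "(\<lambda>x. (x \<bullet> i) * p x) = (\<lambda>x. \<Sum>\<alpha>\<in>up ` A. c (down \<alpha>) * (\<Prod>b\<in>Basis. (x \<bullet> b) ^ \<alpha> b))"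
    unfolding A(3) sum.reindex[OF inj] by (simp add: fun_eq_iff du mon sum_distrib_left mult_ac)
  then show ?thesis
    unfolding poly_fun_deg_le_def using A(1,2) deg
    by (intro exI[of _ "up ` A"] exI[of _ "\<lambda>\<alpha>. c (down \<alpha>)"]) auto
qed

lemma poly_fun_deg_le_zero: "poly_fun_deg_le t (\<lambda>_. 0)"
  unfolding poly_fun_deg_le_def by (intro exI[of _ "{}"]) simp

lemma poly_fun_deg_le_sum:
  assumes "finite I" "\<And>i. i \<in> I \<Longrightarrow> poly_fun_deg_le t (p i)"
  shows "poly_fun_deg_le t (\<lambda>x. \<Sum>i\<in>I. p i x)"
  using assms
proof (induction I rule: finite_induct)
  case (insert i I)
  then show ?case by (simp add: poly_fun_deg_le_add)
qed (simp add: poly_fun_deg_le_zero)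

lemma poly_fun_deg_le_inner_power:
  fixes e :: "'a::euclidean_space"
  shows "poly_fun_deg_le k (\<lambda>x. (x \<bullet> e) ^ k)"
proof (induction k)
  case 0
  show ?case unfolding poly_fun_deg_le_def
    by (intro exI[of _ "{\<lambda>_. 0}"] exI[of _ "\<lambda>_. 1"]) simp
next
  case (Suc k)
  have "(\<lambda>x. (x \<bullet> e) ^ Suc k) = (\<lambda>x. \<Sum>b\<in>Basis. (e \<bullet> b) * ((x \<bullet> b) * (x \<bullet> e) ^ k))"
  proof
    fix x :: 'a
    have "(x \<bullet> e) ^ Suc k = (\<Sum>b\<in>Basis. (x \<bullet> b) * (e \<bullet> b)) * (x \<bullet> e) ^ k"
      by (simp only: power_Suc euclidean_inner[of x e, symmetric])
    then show "(x \<bullet> e) ^ Suc k = (\<Sum>b\<in>Basis. (e \<bullet> b) * ((x \<bullet> b) * (x \<bullet> e) ^ k))"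
      by (simp only: sum_distrib_right) (simp only: mult_ac)
  qed
  then show ?case
    using Suc
      by (simp only:) (intro poly_fun_deg_le_sum poly_fun_deg_le_cmul poly_fun_deg_le_coordinate finite_Basis)
qed

lemma poly_fun_deg_le_zonal:
  assumes "degree q \<le> t"
  shows "poly_fun_deg_le t (\<lambda>x. poly q (x \<bullet> e))"
  unfolding poly_altdef using assms
  by (intro poly_fun_deg_le_sum poly_fun_deg_le_cmul poly_fun_deg_le_mono[OF poly_fun_deg_le_inner_power]) auto

text \<open>The projection of the sphere measure to a line is \<open>\<mu>\<close>, tested on polynomials: the moments of both
satisfy the same two-step recursion with the same initial values.\<close>

lemma integral_zonal:
  fixes e :: "'a::euclidean_space"
  assumes e: "norm e = 1" and d: "DIM('a) \<ge> 2"
  shows "(\<integral>u. poly q (u \<bullet> e) \<partial>sphere_prob) = (\<integral>s. poly q s \<partial>mu DIM('a))"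
proof -
  have mom: "(\<integral>u. (u \<bullet> e) ^ k \<partial>sphere_prob) = (\<integral>s. s ^ k \<partial>mu DIM('a))" for k
  proof (induction k rule: induct_nat_012)
    case (ge2 k)
    then show ?case
      using sphere_moments(4)[OF e, of k] mu_moments(3)[OF d, of k] by simp
  qed (use sphere_moments(2,3)[OF e] mu_moments(1,2)[OF d] in simp_all)
  have int: "integrable (mu DIM('a)) (\<lambda>s. s ^ i)" for i
  proof -
    have "poly (monom 1 i) = (\<lambda>s::real. s ^ i)" by (simp add: fun_eq_iff poly_monom)
    then show ?thesis using integrable_poly_mu[OF d, of "monom 1 i"] by simp
  qed
  have "(\<integral>u. poly q (u \<bullet> e) \<partial>sphere_prob) = (\<Sum>i\<le>degree q. coeff q i * (\<integral>u. (u \<bullet> e) ^ i \<partial>sphere_prob))"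
    unfolding poly_altdef using sphere_moments(1)[OF e]
    by (subst Bochner_Integration.integral_sum) auto
  also have "\<dots> = (\<Sum>i\<le>degree q. coeff q i * (\<integral>s. s ^ i \<partial>mu DIM('a)))" by (simp only: mom)
  also have "\<dots> = (\<integral>s. poly q s \<partial>mu DIM('a))"
    unfolding poly_altdef using int by (subst Bochner_Integration.integral_sum) auto
  finally show ?thesis .
qed

lemma design_zonal_average:
  fixes X :: "'a::euclidean_space set"
  assumes "spherical_design t X" "norm e = 1" "DIM('a) \<ge> 2" "degree q \<le> t"
  shows "(\<Sum>x\<in>X. poly q (e \<bullet> x)) / real (card X) = (\<integral>s. poly q s \<partial>mu DIM('a))"
  using assms(1) poly_fun_deg_le_zonal[OF assms(4), of e] integral_zonal[OF assms(2,3), of q]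
  unfolding spherical_design_def by (simp add: inner_commute)

section \<open>Extremality of the quadrature nodes\<close>

lemma positive_functional_mu:
  assumes "d \<ge> 2"
  shows "positive_functional (\<lambda>q. \<integral>s. poly q s \<partial>mu d)"
proof
  fix p q :: "real poly" and a :: real
  show "(\<integral>s. poly (p + q) s \<partial>mu d) = (\<integral>s. poly p s \<partial>mu d) + (\<integral>s. poly q s \<partial>mu d)"
    using integrable_poly_mu[OF assms] by simp
  show "(\<integral>s. poly (smult a p) s \<partial>mu d) = a * (\<integral>s. poly p s \<partial>mu d)" by simp
qed (rule integral_poly_mu_pos[OF assms])

lemma positive_functional_mu_plus:
  assumes "d \<ge> 2"
  shows "positive_functional (\<lambda>q. \<integral>s. poly q s \<partial>mu_plus d)"
proof -
  interpret L: positive_functional "\<lambda>q. \<integral>s. poly q s \<partial>mu d"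
    by (rule positive_functional_mu[OF assms])
  show ?thesis
    unfolding integral_poly_mu_plus[OF assms]
  proof
    fix p q :: "real poly" and a :: real
    show "(\<integral>s. poly ([:1, 1:] * (p + q)) s \<partial>mu d)
        = (\<integral>s. poly ([:1, 1:] * p) s \<partial>mu d) + (\<integral>s. poly ([:1, 1:] * q) s \<partial>mu d)"
      unfolding distrib_left by (rule L.add)
    show "(\<integral>s. poly ([:1, 1:] * smult a p) s \<partial>mu d) = a * (\<integral>s. poly ([:1, 1:] * p) s \<partial>mu d)"
      unfolding mult_smult_right by (rule L.smult)
  next
    fix q :: "real poly" assume q: "q \<noteq> 0" "\<And>s. -1 < s \<Longrightarrow> s < 1 \<Longrightarrow> poly q s \<ge> 0"
    show "(\<integral>s. poly ([:1, 1:] * q) s \<partial>mu d) > 0"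
    proof (rule L.pos)
      show "[:1, 1:] * q \<noteq> 0" using q(1) by (simp del: mult_pCons_left)
      show "poly ([:1, 1:] * q) s \<ge> 0" if "-1 < s" "s < 1" for s
        using q(2)[OF that] that by (simp only: poly_mult) (intro mult_nonneg_nonneg, auto)
    qed
  qed
qed

definition node_poly :: "real set \<Rightarrow> real poly" where
  "node_poly A = (\<Prod>a\<in>A. [:-a, 1:])"

lemma node_poly_nonzero: "finite A \<Longrightarrow> node_poly A \<noteq> 0"
  by (simp add: node_poly_def)

lemma degree_node_poly: "degree (node_poly A) = card A"
  by (cases "finite A") (simp_all add: node_poly_def degree_prod_eq_sum_degree)

lemma poly_node_poly_eq_0_iff: "finite A \<Longrightarrow> poly (node_poly A) s = 0 \<longleftrightarrow> s \<in> A"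
  by (auto simp: node_poly_def poly_prod)

lemma node_poly_remove:
  "finite A \<Longrightarrow> a \<in> A \<Longrightarrow> node_poly A = [:-a, 1:] * node_poly (A - {a})"
  unfolding node_poly_def by (rule prod.remove)

abbreviation quad_zeros :: "nat \<Rightarrow> nat \<Rightarrow> real set" where
  "quad_zeros t d \<equiv> {s. poly (quad_poly t d) s = 0}"

text \<open>In the even case the orthogonality to lower degrees holds for \<open>(1 + s) \<mu>\<close>. Moving the factor
\<open>1 + s\<close> from the measure to the polynomial turns the zeros into all nodes including \<open>-1\<close>, which
makes the last statement uniform in the parity of \<open>t\<close>.\<close>

lemma quad_zeros_properties:
  assumes d: "d \<ge> 2"
  shows "quad_zeros t d \<subseteq> {-1<..<1}" "card (quad_zeros t d) = (t + 1) div 2"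
    "finite (quad_zeros t d)"
    "\<And>q. degree q < (t + 1) div 2 \<Longrightarrow> (\<integral>s. poly (node_poly (quad_nodes t d) * q) s \<partial>mu d) = 0"
proof -
  let ?Z = "quad_zeros t d" and ?m = "(t + 1) div 2"
  define M where "M = (if odd t then mu d else mu_plus d)"
  interpret L: positive_functional "\<lambda>q. \<integral>s. poly q s \<partial>M"
    using positive_functional_mu[OF d] positive_functional_mu_plus[OF d] by (simp add: M_def)
  let ?ortho = "\<lambda>p. degree p = ?m \<and> lead_coeff p = 1
    \<and> (\<forall>q. degree q < ?m \<longrightarrow> (\<integral>s. poly (p * q) s \<partial>M) = 0)"
  define p where "p = (THE p. ?ortho p)"
  have p: "quad_poly t d = p"
    by (auto simp: quad_poly_def orth_poly_def M_def p_def)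
  have "?ortho p" unfolding p_def by (rule theI'[OF L.ex1_monic_orthogonal])
  then have ortho: "?ortho (quad_poly t d)" unfolding p .
  have roots: "?Z \<subseteq> {-1<..<1} \<and> card ?Z = ?m \<and> quad_poly t d = (\<Prod>a\<in>?Z. [:-a, 1:])"
    using ortho by (intro L.orthogonal_roots) blast+
  then show "?Z \<subseteq> {-1<..<1}" "card ?Z = ?m" by blast+
  have factor: "node_poly ?Z = quad_poly t d"
    unfolding node_poly_def using roots[THEN conjunct2, THEN conjunct2] by (rule sym)
  have "quad_poly t d \<noteq> 0" using ortho by auto
  then show fin: "finite ?Z" by (rule poly_roots_finite)
  show "(\<integral>s. poly (node_poly (quad_nodes t d) * q) s \<partial>mu d) = 0" if q: "degree q < ?m" for q
  proof (cases "odd t")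
    case True
    then have "node_poly (quad_nodes t d) = quad_poly t d"
      using factor by (simp add: quad_nodes_def)
    then show ?thesis using ortho q True by (simp add: M_def)
  next
    case False
    have "-1 \<notin> ?Z" using roots by force
    then have "node_poly (insert (-1) ?Z) = [:1, 1:] * node_poly ?Z"
      using fin unfolding node_poly_def by (subst prod.insert) simp_all
    then have "node_poly (quad_nodes t d) = [:1, 1:] * quad_poly t d"
      using False factor by (simp add: quad_nodes_def)
    moreover have "(\<integral>s. poly (quad_poly t d * q) s \<partial>mu_plus d) = 0"
      using ortho q False by (simp add: M_def)
    ultimately show ?thesis unfolding integral_poly_mu_plus[OF d] by (simp only: mult.assoc)
  qed
qed

lemma quad_nodes_properties:
  assumes d: "d \<ge> 2" and t: "t \<ge> 2"
  shows "finite (quad_nodes t d)" "card (quad_nodes t d) = t div 2 + 1"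
    "quad_eta t d \<in> quad_zeros t d" "\<And>s. s \<in> quad_nodes t d \<Longrightarrow> -1 \<le> s \<and> s \<le> quad_eta t d"
    "bij_betw (quad_node t d) {..t div 2} (quad_nodes t d)" "quad_node t d (t div 2) = quad_eta t d"
proof -
  note Z = quad_zeros_properties[where t = t, OF d]
  show fin: "finite (quad_nodes t d)" using Z(3) by (simp add: quad_nodes_def)
  have "-1 \<notin> quad_zeros t d" using Z(1) by force
  show card: "card (quad_nodes t d) = t div 2 + 1"
  proof (cases "odd t")
    case True
    then have "card (quad_nodes t d) = (t + 1) div 2" using Z(2) by (simp add: quad_nodes_def)
    then show ?thesis using True by presburger
  next
    case False
    then have "card (quad_nodes t d) = Suc ((t + 1) div 2)"
      using Z(2,3) \<open>-1 \<notin> quad_zeros t d\<close> by (simp add: quad_nodes_def)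
    then show ?thesis using False by presburger
  qed
  have "quad_zeros t d \<noteq> {}" using Z(2) t by force
  then show eta: "quad_eta t d \<in> quad_zeros t d"
    unfolding quad_eta_def using Z(3) by (rule Max_in[rotated])
  have max: "s \<le> quad_eta t d" if "s \<in> quad_zeros t d" for s
    unfolding quad_eta_def using Z(3) that by (rule Max_ge)
  have "quad_eta t d > -1" using eta Z(1) by force
  then show range: "-1 \<le> s \<and> s \<le> quad_eta t d" if "s \<in> quad_nodes t d" for s
  proof -
    have "s \<in> quad_zeros t d \<or> s = -1" using that by (auto simp: quad_nodes_def split: if_splits)
    then show ?thesis using max Z(1) \<open>quad_eta t d > -1\<close> by force
  qed
  let ?l = "sorted_list_of_set (quad_nodes t d)"
  have len: "length ?l = Suc (t div 2)" using card by simp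
  have set: "set ?l = quad_nodes t d" using fin by simp
  have node: "quad_node t d = (!) ?l" by (simp add: quad_node_def fun_eq_iff)
  show bij: "bij_betw (quad_node t d) {..t div 2} (quad_nodes t d)"
    unfolding node using bij_betw_nth[OF distinct_sorted_list_of_set refl set[symmetric]] len
    by (simp add: lessThan_Suc_atMost)
  have "quad_eta t d \<in> quad_nodes t d" using eta by (simp add: quad_nodes_def)
  then obtain k where k: "k \<le> t div 2" "quad_node t d k = quad_eta t d"
    using bij unfolding bij_betw_def by force
  have "quad_node t d k \<le> quad_node t d (t div 2)"
    unfolding node using k(1) len by (intro sorted_nth_mono) auto
  moreover have "quad_node t d (t div 2) \<in> quad_nodes t d" using bij by (auto simp: bij_betw_def)
  ultimately show "quad_node t d (t div 2) = quad_eta t d" using range k(2) by force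
qed

text \<open>With \<open>w = 1\<close> or \<open>w = 1 + s\<close> according to the parity of \<open>t\<close>, this polynomial is
\<open>w (s - \<eta>) \<Prod> (s - a)\<^sup>2\<close>, the product ranging over the zeros \<open>a\<close> other than \<open>\<eta>\<close>. On the
interval it changes sign only at \<open>\<eta>\<close>. Its integral vanishes since the second factor of \<open>q\<close> has
degree below that of the orthogonal polynomial.\<close>

lemma zero_average_test_poly:
  fixes d t :: nat
  assumes d: "d \<ge> 2" and t: "t \<ge> 2"
  defines "q \<equiv> node_poly (quad_nodes t d) * node_poly (quad_zeros t d - {quad_eta t d})"
  shows "degree q = t" "(\<integral>s. poly q s \<partial>mu d) = 0"
    "\<And>s. -1 \<le> s \<Longrightarrow> s \<le> quad_eta t d \<Longrightarrow> poly q s \<le> 0"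
    "\<And>s. poly q s = 0 \<longleftrightarrow> s \<in> quad_nodes t d"
proof -
  note Z = quad_zeros_properties[where t = t, OF d] and N = quad_nodes_properties[OF d t]
  let ?Z = "quad_zeros t d" and ?\<eta> = "quad_eta t d"
  have cardZ: "card (?Z - {?\<eta>}) = (t + 1) div 2 - 1" using Z(2,3) N(3) by simp
  have "degree q = card (quad_nodes t d) + card (?Z - {?\<eta>})"
    unfolding q_def degree_node_poly[symmetric] using N(1) Z(3)
    by (intro degree_mult_eq node_poly_nonzero finite_Diff)
  then show "degree q = t" unfolding cardZ N(2) using t by presburger
  show "(\<integral>s. poly q s \<partial>mu d) = 0"
    unfolding q_def using t by (intro Z(4)) (simp add: degree_node_poly cardZ)
  show "poly q s = 0 \<longleftrightarrow> s \<in> quad_nodes t d" for s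
    unfolding q_def using N(1) Z(3) by (auto simp: poly_node_poly_eq_0_iff quad_nodes_def)
  define w where "w = (if odd t then 1 else [:1, 1:] :: real poly)"
  have "-1 \<notin> ?Z" using Z(1) by force
  then have nodes: "node_poly (quad_nodes t d) = w * node_poly ?Z"
    using Z(3) by (simp add: quad_nodes_def node_poly_def w_def)
  have q: "poly q s = poly w s * (s - ?\<eta>) * (poly (node_poly (?Z - {?\<eta>})) s)\<^sup>2" for s
  proof -
    have "poly (node_poly ?Z) s = (s - ?\<eta>) * poly (node_poly (?Z - {?\<eta>})) s"
      unfolding node_poly_remove[OF Z(3) N(3)] by (simp add: algebra_simps)
    then show ?thesis unfolding q_def nodes by (simp add: power2_eq_square)
  qed
  show "poly q s \<le> 0" if "-1 \<le> s" "s \<le> ?\<eta>" for s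
  proof -
    have "poly w s \<ge> 0" using that by (simp add: w_def)
    then have "poly w s * (s - ?\<eta>) \<le> 0" using that by (intro mult_nonneg_nonpos) auto
    then show ?thesis unfolding q by (rule mult_nonpos_nonneg) simp
  qed
qed

text \<open>The previous test polynomial without the factor \<open>s - \<eta>\<close>. It is nonnegative on the interval and
vanishes at all nodes except \<open>\<eta>\<close>.\<close>

lemma positive_average_test_poly:
  fixes d t :: nat
  assumes d: "d \<ge> 2" and t: "t \<ge> 2"
  defines "q \<equiv> node_poly (quad_nodes t d - {quad_eta t d}) * node_poly (quad_zeros t d - {quad_eta t d})"
  shows "degree q \<le> t" "(\<integral>s. poly q s \<partial>mu d) > 0"
    "\<And>s. s \<in> quad_nodes t d - {quad_eta t d} \<Longrightarrow> poly q s = 0"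
proof -
  note Z = quad_zeros_properties[where t = t, OF d] and N = quad_nodes_properties[OF d t]
  let ?Z = "quad_zeros t d" and ?\<eta> = "quad_eta t d"
  have cardZ: "card (?Z - {?\<eta>}) = (t + 1) div 2 - 1" using Z(2,3) N(3) by simp
  have "?\<eta> \<in> quad_nodes t d" using N(3) by (simp add: quad_nodes_def)
  then have cardN: "card (quad_nodes t d - {?\<eta>}) = t div 2" using N(1,2) by simp
  have "degree q \<le> card (quad_nodes t d - {?\<eta>}) + card (?Z - {?\<eta>})"
    unfolding q_def by (rule order_trans[OF degree_mult_le]) (simp add: degree_node_poly)
  then show "degree q \<le> t" unfolding cardZ cardN by linarith
  show "poly q s = 0" if "s \<in> quad_nodes t d - {?\<eta>}" for s
    unfolding q_def using that N(1) by (simp add: poly_node_poly_eq_0_iff)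
  define w where "w = (if odd t then 1 else [:1, 1:] :: real poly)"
  have "-1 \<notin> ?Z" using Z(1) by force
  then have "-1 \<noteq> ?\<eta>" using N(3) by metis
  with \<open>-1 \<notin> ?Z\<close> have "quad_nodes t d - {?\<eta>} = (?Z - {?\<eta>}) \<union> (if odd t then {} else {-1})"
    by (auto simp: quad_nodes_def)
  then have nodes: "node_poly (quad_nodes t d - {?\<eta>}) = w * node_poly (?Z - {?\<eta>})"
    using Z(3) \<open>-1 \<notin> ?Z\<close> by (simp add: node_poly_def w_def)
  have q: "poly q s = poly w s * (poly (node_poly (?Z - {?\<eta>})) s)\<^sup>2" for s
    unfolding q_def nodes by (simp add: power2_eq_square)
  show "(\<integral>s. poly q s \<partial>mu d) > 0"
  proof (rule integral_poly_mu_pos[OF d])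
    show "q \<noteq> 0" unfolding q_def using N(1) Z(3) node_poly_nonzero by simp
    show "poly q s \<ge> 0" if "-1 < s" "s < 1" for s
      unfolding q using that by (simp add: w_def)
  qed
qed

text \<open>The values \<open>v x\<close> form an equal-weight quadrature rule for \<open>\<mu>\<close> of the same exactness as the
Gauss or Gauss--Radau rule. For a design they are the inner products of its points with a fixed
unit vector.\<close>

locale exact_averages =
  fixes X :: "'a set" and v :: "'a \<Rightarrow> real" and t d :: nat
  assumes finite_X: "finite X" and X_nonempty: "X \<noteq> {}" and d: "d \<ge> 2" and t: "t \<ge> 2"
    and exact: "\<And>q. degree q \<le> t \<Longrightarrow> (\<Sum>x\<in>X. poly q (v x)) / real (card X) = (\<integral>s. poly q s \<partial>mu d)"
    and ge: "\<And>x. x \<in> X \<Longrightarrow> -1 \<le> v x"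
begin

lemma card_pos: "real (card X) > 0"
  using finite_X X_nonempty by (simp add: card_gt_0_iff)

text \<open>The first test polynomial has average zero but is nowhere positive up to \<open>\<eta>\<close>, so every value is
one of its zeros.\<close>

lemma values_in_nodes:
  assumes "\<And>x. x \<in> X \<Longrightarrow> v x \<le> quad_eta t d" "x \<in> X"
  shows "v x \<in> quad_nodes t d"
proof -
  let ?q = "node_poly (quad_nodes t d) * node_poly (quad_zeros t d - {quad_eta t d})"
  note q = zero_average_test_poly[OF d t]
  have "(\<Sum>x\<in>X. poly ?q (v x)) = 0"
    using exact[of ?q] q(1,2) card_pos by simp
  then have "(\<Sum>x\<in>X. - poly ?q (v x)) = 0" by (simp only: sum_negf)
  then have "- poly ?q (v x) = 0"
    using sum_nonneg_eq_0_iff[OF finite_X, of "\<lambda>x. - poly ?q (v x)"] q(3) ge assms by simp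
  then show ?thesis using q(4)[of "v x"] by (simp only: neg_equal_0_iff_equal)
qed

text \<open>Were all values below \<open>\<eta>\<close>, they would be nodes other than \<open>\<eta>\<close>, where the second test polynomial
vanishes in spite of its positive average.\<close>

lemma exists_value_ge_eta: "\<exists>x\<in>X. v x \<ge> quad_eta t d"
proof (rule ccontr)
  assume "\<not> ?thesis"
  then have less: "v x < quad_eta t d" if "x \<in> X" for x using that by (auto simp: not_le)
  let ?q = "node_poly (quad_nodes t d - {quad_eta t d}) * node_poly (quad_zeros t d - {quad_eta t d})"
  note q = positive_average_test_poly[OF d t]
  have "(\<Sum>x\<in>X. poly ?q (v x)) = 0"
  proof (rule sum.neutral, rule ballI)
    fix x assume x: "x \<in> X"
    then have "v x \<in> quad_nodes t d" using less by (intro values_in_nodes) (auto simp: less_imp_le)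
    then show "poly ?q (v x) = 0" using less[OF x] by (intro q(3)) auto
  qed
  then show False using exact[OF q(1)] q(2) by simp
qed

abbreviation multiplicity_at :: "nat \<Rightarrow> nat" where
  "multiplicity_at k \<equiv> card {x \<in> X. v x = quad_node t d k}"

lemma sum_by_nodes:
  assumes nodes: "\<And>x. x \<in> X \<Longrightarrow> v x \<in> quad_nodes t d"
  shows "(\<Sum>x\<in>X. poly q (v x))
    = (\<Sum>k\<le>t div 2. real (multiplicity_at k) * poly q (quad_node t d k))"
proof -
  note N = quad_nodes_properties[OF d t]
  have "(\<Sum>x\<in>X. poly q (v x)) = (\<Sum>y\<in>quad_nodes t d. \<Sum>x | x \<in> X \<and> v x = y. poly q (v x))"
    using nodes by (intro sum.group[symmetric] finite_X N(1)) auto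
  also have "\<dots> = (\<Sum>y\<in>quad_nodes t d. real (card {x \<in> X. v x = y}) * poly q y)"
    by (intro sum.cong refl) simp
  also have "\<dots> = (\<Sum>k\<le>t div 2. real (multiplicity_at k) * poly q (quad_node t d k))"
    using sum.reindex_bij_betw[OF N(5), of "\<lambda>y. real (card {x \<in> X. v x = y}) * poly q y"] by simp
  finally show ?thesis .
qed

text \<open>For the polynomial \<open>l k\<close> of degree \<open>n\<close> that vanishes at all nodes but the \<open>k\<close>-th, exactness
determines the \<open>k\<close>-th weight of any rule on the nodes; the relative multiplicities form such a
rule. Applied to the square of \<open>l k\<close>, whose degree \<open>2 n\<close> is at most \<open>t\<close>, exactness shows that
the multiplicity is not zero.\<close>

lemma node_multiplicities:
  assumes nodes: "\<And>x. x \<in> X \<Longrightarrow> v x \<in> quad_nodes t d" and k: "k \<le> t div 2"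
  shows "multiplicity_at k > 0" "real (multiplicity_at k) = real (card X) * quad_weight t d k"
proof -
  note N = quad_nodes_properties[OF d t]
  let ?n = "t div 2" and ?\<xi> = "quad_node t d"
  define l where "l = (\<lambda>k. node_poly (quad_nodes t d - {?\<xi> k}))"
  have \<xi>_mem: "?\<xi> k \<in> quad_nodes t d" if "k \<le> ?n" for k using N(5) that by (auto simp: bij_betw_def)
  have \<xi>_inj: "?\<xi> i = ?\<xi> k \<longleftrightarrow> i = k" if "i \<le> ?n" "k \<le> ?n" for i k
    using N(5) that by (auto simp: bij_betw_def inj_on_def)
  have deg_l: "degree (l k) = ?n" if "k \<le> ?n" for k
    using N(1,2) \<xi>_mem[OF that] by (simp add: l_def degree_node_poly)
  have l_eq_0: "poly (l k) (?\<xi> i) = 0 \<longleftrightarrow> i \<noteq> k" if "i \<le> ?n" "k \<le> ?n" for i k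
    using that N(1) \<xi>_mem \<xi>_inj by (simp add: l_def poly_node_poly_eq_0_iff)
  \<comment> \<open>Used for the first power, which isolates a weight, and for the square, which is nonnegative.\<close>
  have pick: "(\<Sum>i\<le>?n. g i * poly (l k ^ Suc j) (?\<xi> i)) = g k * poly (l k ^ Suc j) (?\<xi> k)"
    if "k \<le> ?n" for g k j
  proof -
    have "(\<Sum>i\<le>?n. g i * poly (l k ^ Suc j) (?\<xi> i))
        = (\<Sum>i\<le>?n. if i = k then g k * poly (l k ^ Suc j) (?\<xi> k) else 0)"
      using that l_eq_0 by (intro sum.cong refl) (auto simp: poly_power)
    then show ?thesis using that by simp
  qed
  have sum_l: "(\<Sum>x\<in>X. poly (l k ^ Suc j) (v x))
      = real (multiplicity_at k) * poly (l k ^ Suc j) (?\<xi> k)" if "k \<le> ?n" for k j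
    by (rule trans[OF sum_by_nodes[OF nodes, of "l k ^ Suc j"]
          pick[OF that, of "\<lambda>i. real (multiplicity_at i)" j]])
  have "real (multiplicity_at k) > 0"
  proof -
    have "degree (l k ^ Suc 1) \<le> degree (l k) * Suc 1" by (rule degree_power_le)
    also have "\<dots> \<le> t" using deg_l[OF k] by presburger
    finally have "(\<Sum>x\<in>X. poly (l k ^ Suc 1) (v x)) / real (card X) = (\<integral>s. poly (l k ^ Suc 1) s \<partial>mu d)"
      by (rule exact)
    moreover have "(\<integral>s. poly (l k ^ Suc 1) s \<partial>mu d) > 0"
    proof (rule integral_poly_mu_pos[OF d])
      show "l k ^ Suc 1 \<noteq> 0" using N(1) by (simp add: l_def node_poly_nonzero)
    qed (simp add: poly_power)
    ultimately have "multiplicity_at k \<noteq> 0"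
      using sum_l[OF k, of 1] by (metis div_0 less_irrefl mult_zero_left of_nat_0)
    then show ?thesis by simp
  qed
  then show "multiplicity_at k > 0" by simp
  define w where "w = (\<lambda>k. if k \<le> ?n then real (multiplicity_at k) / real (card X) else 0)"
  have "quad_weight t d = w"
    unfolding quad_weight_def
  proof (rule the_equality, safe)
    fix q :: "real poly" assume "degree q \<le> t"
    have "(\<Sum>k\<le>?n. w k * poly q (?\<xi> k))
        = (\<Sum>k\<le>?n. real (multiplicity_at k) * poly q (?\<xi> k)) / real (card X)"
      unfolding sum_divide_distrib by (intro sum.cong) (auto simp: w_def)
    then show "(\<Sum>k\<le>?n. w k * poly q (?\<xi> k)) = (\<integral>s. poly q s \<partial>mu d)"
      using exact[OF \<open>degree q \<le> t\<close>] sum_by_nodes[OF nodes] by simp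
  next
    fix w' assume w': "\<forall>k>?n. w' k = 0"
      "\<forall>q. degree q \<le> t \<longrightarrow> (\<Sum>k\<le>?n. w' k * poly q (?\<xi> k)) = (\<integral>s. poly q s \<partial>mu d)"
    show "w' = w"
    proof
      fix i
      show "w' i = w i"
      proof (cases "i \<le> ?n")
        case True
        have deg: "degree (l i ^ Suc 0) \<le> t" using deg_l[OF True] by simp
        have "w' i * poly (l i ^ Suc 0) (?\<xi> i) = (\<integral>s. poly (l i ^ Suc 0) s \<partial>mu d)"
          using w'(2) deg pick[OF True, of w' 0] by simp
        also have "\<dots> = (\<Sum>x\<in>X. poly (l i ^ Suc 0) (v x)) / real (card X)"
          using exact[OF deg] by simp
        also have "\<dots> = w i * poly (l i ^ Suc 0) (?\<xi> i)"
          using sum_l[OF True, of 0] True by (simp add: w_def)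
        finally show ?thesis using l_eq_0[OF True True] by simp
      qed (use w'(1) in \<open>simp add: w_def\<close>)
    qed
  qed (simp add: w_def)
  then show "real (multiplicity_at k) = real (card X) * quad_weight t d k"
    using k card_pos by (simp add: w_def)
qed

end


section \<open>A self-polar polytope whose facets touch a common sphere\<close>

lemma support_fun_eqI:
  assumes "\<And>y. y \<in> P \<Longrightarrow> u \<bullet> y \<le> b" "y0 \<in> P" "u \<bullet> y0 = b"
  shows "support_fun P u = b"
  unfolding support_fun_def using assms(1,2) assms(3)[symmetric]
  by (intro cSup_eq_maximum) blast+

lemma le_support_fun:
  assumes "compact P" "y \<in> P"
  shows "u \<bullet> y \<le> support_fun P u"
proof -
  have "bdd_above ((\<bullet>) u ` P)"
    using assms(1) by (intro bounded_imp_bdd_above compact_imp_bounded compact_continuous_image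
        continuous_on_inner continuous_on_const continuous_on_id)
  then show ?thesis unfolding support_fun_def using assms(2) by (intro cSUP_upper)
qed

text \<open>An irredundant presentation by halfspaces has one halfspace per facet, and after normalization of
its normal vector each of these is the supporting halfspace at that facet.\<close>

lemma polytope_eq_facet_halfspaces:
  fixes P :: "'a::euclidean_space set"
  assumes P: "polytope P" and full: "aff_dim P = int DIM('a)"
  shows "P = {y. \<forall>u\<in>outer_unit_normals P. u \<bullet> y \<le> support_fun P u}"
proof
  show "P \<subseteq> {y. \<forall>u\<in>outer_unit_normals P. u \<bullet> y \<le> support_fun P u}"
    using le_support_fun[OF polytope_imp_compact[OF P]] by blast
next
  have aff: "affine hull P = UNIV" using full by (simp add: aff_dim_eq_full)
  obtain F where "finite F" and seq: "P = affine hull P \<inter> \<Inter>F"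
    and faces: "\<And>H. H \<in> F \<Longrightarrow> \<exists>a b. a \<noteq> 0 \<and> H = {x. a \<bullet> x \<le> b}"
    and min: "\<And>F'. F' \<subset> F \<Longrightarrow> P \<subset> (affine hull P) \<inter> \<Inter>F'"
    using polytope_imp_polyhedron[OF P] by (simp add: polyhedron_Int_affine_minimal) meson
  then obtain a b where ab: "\<And>H. H \<in> F \<Longrightarrow> a H \<noteq> 0 \<and> H = {x. a H \<bullet> x \<le> b H}"
    by metis
  have normal: "\<exists>u\<in>outer_unit_normals P. H = {y. u \<bullet> y \<le> support_fun P u}" if "H \<in> F" for H
  proof -
    define u where "u = a H /\<^sub>R norm (a H)"
    have aH: "norm (a H) > 0" and H: "H = {x. a H \<bullet> x \<le> b H}"
      using ab[OF that] zero_less_norm_iff by blast+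
    have u1: "norm u = 1" using aH by (simp add: u_def)
    have ux: "u \<bullet> y = (a H \<bullet> y) / norm (a H)" for y by (simp add: u_def divide_inverse mult.commute)
    have facet: "(P \<inter> {y. a H \<bullet> y = b H}) facet_of P"
      using facet_of_polyhedron_explicit[OF \<open>finite F\<close> seq ab min] that by blast
    then obtain y0 where y0: "y0 \<in> P" "a H \<bullet> y0 = b H" by (auto simp: facet_of_def)
    have "P \<subseteq> H" using seq that by blast
    then have le: "a H \<bullet> y \<le> b H" if "y \<in> P" for y using H that by blast
    have sup: "support_fun P u = b H / norm (a H)"
      using le y0 aH by (intro support_fun_eqI[of P u _ y0]) (auto simp: ux divide_right_mono)
    have "support_face P u = P \<inter> {y. a H \<bullet> y = b H}"
      using aH by (auto simp: support_face_def sup ux)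
    moreover have "H = {y. u \<bullet> y \<le> support_fun P u}"
    proof -
      have "{x. a H \<bullet> x \<le> b H} = {y. u \<bullet> y \<le> support_fun P u}"
        using aH by (auto simp: sup ux divide_le_cancel)
      with H show ?thesis by (rule trans)
    qed
    ultimately show ?thesis using facet u1 by (auto simp: outer_unit_normals_def)
  qed
  show "{y. \<forall>u\<in>outer_unit_normals P. u \<bullet> y \<le> support_fun P u} \<subseteq> P"
  proof
    fix y assume y: "y \<in> {y. \<forall>u\<in>outer_unit_normals P. u \<bullet> y \<le> support_fun P u}"
    have "y \<in> H" if "H \<in> F" for H using normal[OF that] y by blast
    then show "y \<in> P" using seq aff by blast
  qed
qed

text \<open>A point outside the convex hull is separated from it by a vector \<open>w\<close>. If the separating level
\<open>- b\<close> is positive, a rescaling of \<open>w\<close> lies in the body and violates the polar inequality;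
otherwise the body contains the ray through \<open>w\<close> and is unbounded.\<close>

lemma polar_body_of_tangential:
  fixes X :: "'a::euclidean_space set"
  assumes X: "finite X" "X \<noteq> {}" and h: "h > 0"
    and bd: "bounded {y. \<forall>x\<in>X. x \<bullet> y \<le> h}"
  shows "polar_body {y. \<forall>x\<in>X. x \<bullet> y \<le> h} = convex hull ((\<lambda>x. x /\<^sub>R h) ` X)" (is "polar_body ?P = ?Q")
proof
  have "convex (polar_body ?P)"
    unfolding polar_body_def convex_def
    by (auto simp: inner_add_left intro: convex_bound_le)
  moreover have "(\<lambda>x. x /\<^sub>R h) ` X \<subseteq> polar_body ?P"
    using h by (auto simp: polar_body_def field_simps)
  ultimately show "?Q \<subseteq> polar_body ?P" by (rule hull_minimal[rotated])
next
  show "polar_body ?P \<subseteq> ?Q"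
  proof (rule ccontr)
    assume "\<not> ?thesis"
    then obtain z where z: "z \<in> polar_body ?P" "z \<notin> ?Q" by blast
    have "closed ?Q" using X by (intro compact_imp_closed finite_imp_compact_convex_hull) simp
    then obtain a b where ab: "a \<bullet> z < b" "\<And>q. q \<in> ?Q \<Longrightarrow> a \<bullet> q > b"
      using separating_hyperplane_closed_point[of ?Q z] z(2) by auto
    define w where "w = - a"
    have wz: "w \<bullet> z > - b" using ab(1) by (simp add: w_def)
    have wx: "x \<bullet> w < - b * h" if "x \<in> X" for x
    proof -
      have "a \<bullet> (x /\<^sub>R h) > b" using that by (intro ab(2) hull_inc) blast
      then show ?thesis using h by (simp add: w_def field_simps inner_commute)
    qed
    show False
    proof (cases "b < 0")
      case True
      have "x \<bullet> (w /\<^sub>R (- b)) \<le> h" if "x \<in> X" for x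
      proof -
        have "(x \<bullet> w) / (- b) < h"
          using wx[OF that] True by (subst pos_divide_less_eq) (auto simp: mult.commute)
        then show ?thesis by (simp add: divide_inverse mult.commute)
      qed
      then have "w /\<^sub>R (- b) \<in> ?P" by blast
      then have "z \<bullet> (w /\<^sub>R (- b)) \<le> 1" using z(1) unfolding polar_body_def by blast
      moreover have "(w \<bullet> z) / (- b) > 1" using wz True by (subst pos_less_divide_eq) auto
      ultimately show False by (simp add: divide_inverse mult.commute inner_commute)
    next
      case False
      have neg: "x \<bullet> w < 0" if "x \<in> X" for x
      proof -
        have "b * h \<ge> 0" using False h by (intro mult_nonneg_nonneg) auto
        then show ?thesis using wx[OF that] by simp
      qed
      have "w \<noteq> 0" using neg X(2) by force
      obtain B where B: "\<And>y. y \<in> ?P \<Longrightarrow> norm y \<le> B" using bd by (auto simp: bounded_iff)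
      \<comment> \<open>This multiple of \<open>w\<close> has norm \<open>\<bar>B\<bar> + 1\<close>.\<close>
      define l where "l = (\<bar>B\<bar> + 1) / norm w"
      have "l > 0" using \<open>w \<noteq> 0\<close> by (simp add: l_def)
      then have "x \<bullet> (l *\<^sub>R w) \<le> h" if "x \<in> X" for x
        using mult_pos_neg[OF _ neg[OF that], of l] h by simp
      then have "norm (l *\<^sub>R w) \<le> B" by (intro B) blast
      then show False using \<open>w \<noteq> 0\<close> by (simp add: l_def)
    qed
  qed
qed

text \<open>The norm is strictly smaller in the interior of a segment than at its farther end.\<close>

lemma extreme_point_of_convex_hull_on_sphere:
  fixes Y :: "'a::euclidean_space set"
  assumes Y: "\<And>y. y \<in> Y \<Longrightarrow> norm y = \<rho>"
  shows "v extreme_point_of (convex hull Y) \<longleftrightarrow> v \<in> Y"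
proof
  assume "v extreme_point_of (convex hull Y)"
  then show "v \<in> Y" by (rule extreme_point_of_convex_hull)
next
  assume v: "v \<in> Y"
  have sub: "convex hull Y \<subseteq> cball 0 \<rho>" by (rule hull_minimal) (auto simp: Y)
  show "v extreme_point_of (convex hull Y)"
    unfolding extreme_point_of_def
  proof (intro conjI ballI notI)
    show "v \<in> convex hull Y" using v by (rule hull_inc)
  next
    fix a b assume ab: "a \<in> convex hull Y" "b \<in> convex hull Y" "v \<in> open_segment a b"
    then have "a \<in> cball 0 \<rho>" "b \<in> cball 0 \<rho>" using sub by blast+
    then have "norm v < \<rho>"
      using dist_decreases_open_segment[OF ab(3), of 0] by simp linarith
    then show False using Y[OF v] by simp
  qed
qed

lemma orthogonal_transformation_adjoint_inv:
  fixes U :: "'a::euclidean_space \<Rightarrow> 'a"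
  assumes "orthogonal_transformation U"
  shows "x \<bullet> inv U y = U x \<bullet> y"
proof -
  have "x \<bullet> inv U y = U x \<bullet> U (inv U y)"
    using assms by (simp add: orthogonal_transformation_def)
  also have "U (inv U y) = y"
    using orthogonal_transformation_surj[OF assms] by (rule surj_f_inv_f)
  finally show ?thesis .
qed

lemma tangential_inradius:
  fixes X :: "'a::euclidean_space set"
  assumes "X \<subseteq> sphere 0 1" "X \<noteq> {}" "h \<ge> 0"
  shows "centered_inradius {y. \<forall>x\<in>X. x \<bullet> y \<le> h} = h"
proof -
  have "cball 0 \<rho> \<subseteq> {y. \<forall>x\<in>X. x \<bullet> y \<le> h} \<longleftrightarrow> \<rho> \<le> h" if "0 \<le> \<rho>" for \<rho>
  proof
    assume sub: "cball 0 \<rho> \<subseteq> {y. \<forall>x\<in>X. x \<bullet> y \<le> h}"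
    obtain x where x: "x \<in> X" "norm x = 1" using assms by force
    have "\<rho> *\<^sub>R x \<in> cball 0 \<rho>" using x that by simp
    then have "x \<bullet> (\<rho> *\<^sub>R x) \<le> h" using sub x by blast
    then show "\<rho> \<le> h" using x by (simp add: dot_square_norm)
  next
    assume "\<rho> \<le> h"
    show "cball 0 \<rho> \<subseteq> {y. \<forall>x\<in>X. x \<bullet> y \<le> h}"
    proof safe
      fix y x :: 'a assume "y \<in> cball 0 \<rho>" "x \<in> X"
      moreover have "x \<bullet> y \<le> norm x * norm y" by (rule norm_cauchy_schwarz)
      ultimately show "x \<bullet> y \<le> h" using assms(1) \<open>\<rho> \<le> h\<close> by (auto simp: subset_iff)
    qed
  qed
  then have "{\<rho>. 0 \<le> \<rho> \<and> cball 0 \<rho> \<subseteq> {y. \<forall>x\<in>X. x \<bullet> y \<le> h}} = {\<rho>. 0 \<le> \<rho> \<and> \<rho> \<le> h}"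
    by (intro Collect_cong) blast
  also have "\<dots> = {0..h}" by auto
  finally show ?thesis using assms(3) by (simp add: centered_inradius_def)
qed

lemma circumradius_convex_hull_sphere:
  assumes "\<And>y. y \<in> Y \<Longrightarrow> norm y = \<rho>" "Y \<noteq> {}"
  shows "centered_circumradius (convex hull Y) = \<rho>"
proof -
  obtain y where "y \<in> Y" using assms(2) by blast
  then have "\<rho> \<ge> 0" using assms(1) norm_ge_zero by metis
  have "convex hull Y \<subseteq> cball 0 r \<longleftrightarrow> \<rho> \<le> r" for r
  proof
    assume "convex hull Y \<subseteq> cball 0 r"
    then have "y \<in> cball 0 r" using hull_inc[OF \<open>y \<in> Y\<close>, of convex] by blast
    then show "\<rho> \<le> r" using assms(1)[OF \<open>y \<in> Y\<close>] by simp
  next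
    assume "\<rho> \<le> r"
    then show "convex hull Y \<subseteq> cball 0 r" using assms(1) by (intro hull_minimal) auto
  qed
  then have "{r. 0 \<le> r \<and> convex hull Y \<subseteq> cball 0 r} = {\<rho>..}" using \<open>\<rho> \<ge> 0\<close> by auto
  then show ?thesis by (simp add: centered_circumradius_def)
qed

text \<open>The polar of \<open>P\<close> is a similar copy of the bounded set \<open>P\<close>. This forces \<open>h > 0\<close>, since for
\<open>h \<le> 0\<close> the polar would contain the ray through any normal; and it identifies \<open>P\<close> with the image
under \<open>U\<^sup>-\<^sup>1\<close> of the hull of the points \<open>x / h\<close>, shrunk by \<open>c\<close>.\<close>

lemma vertices_of_self_polar:
  fixes X P :: "'a::euclidean_space set"
  assumes X: "finite X" "X \<subseteq> sphere 0 1"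
    and P: "minkowski_polytope X P" and h: "\<forall>x\<in>X. support_fun P x = h"
    and c: "c > 0" and U: "orthogonal_transformation U"
    and polar: "polar_body P = (\<lambda>y. c *\<^sub>R U y) ` P"
  defines "V \<equiv> (\<lambda>x. inv U x /\<^sub>R (c * h)) ` X"
  shows "h > 0" "X \<noteq> {}" "P = {y. \<forall>x\<in>X. x \<bullet> y \<le> h}" "P = convex hull V"
proof -
  have poly: "polytope P" and full: "aff_dim P = int DIM('a)" and norms: "outer_unit_normals P = X"
    using P by (auto simp: minkowski_polytope_def)
  have bdP: "bounded P" using poly by (rule polytope_imp_bounded)
  have "P = {y. \<forall>x\<in>X. x \<bullet> y \<le> support_fun P x}"
    using polytope_eq_facet_halfspaces[OF poly full] unfolding norms .
  also have "\<dots> = {y. \<forall>x\<in>X. x \<bullet> y \<le> h}" using h by auto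
  finally show Peq: "P = {y. \<forall>x\<in>X. x \<bullet> y \<le> h}" .
  show Xne: "X \<noteq> {}" using Peq bdP not_bounded_UNIV[where 'a = 'a] by auto
  have lU: "linear U" using U by (rule orthogonal_transformation_linear)
  have bdpol: "bounded (polar_body P)"
  proof -
    have "bounded (U ` P)"
      by (rule bounded_linear_image[OF bdP]) (use lU in \<open>simp add: linear_conv_bounded_linear\<close>)
    then have "bounded ((*\<^sub>R) c ` U ` P)" by (rule bounded_scaling)
    then show ?thesis unfolding polar image_image .
  qed
  show hpos: "h > 0"
  proof (rule ccontr)
    assume nh: "\<not> h > 0"
    obtain x where x: "x \<in> X" "norm x = 1" using X Xne by force
    obtain B where B: "\<And>z. z \<in> polar_body P \<Longrightarrow> norm z \<le> B" using bdpol by (auto simp: bounded_iff)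
    have "(\<bar>B\<bar> + 1) * (x \<bullet> y) \<le> 1" if "y \<in> P" for y
    proof -
      have "x \<bullet> y \<le> 0" using that x nh Peq by fastforce
      then have "(\<bar>B\<bar> + 1) * (x \<bullet> y) \<le> 0" by (intro mult_nonneg_nonpos) auto
      then show ?thesis by simp
    qed
    then have "norm ((\<bar>B\<bar> + 1) *\<^sub>R x) \<le> B" by (intro B) (auto simp: polar_body_def)
    then show False using x by simp
  qed
  have linU': "linear (inv U)"
    using U orthogonal_transformation_inv orthogonal_transformation_linear by blast
  have dual: "(\<lambda>y. c *\<^sub>R U y) ` P = convex hull ((\<lambda>x. x /\<^sub>R h) ` X)"
    using polar_body_of_tangential[OF X(1) Xne hpos] bdP
    unfolding Peq[symmetric] polar by blast
  have "P = (\<lambda>z. inv U z /\<^sub>R c) ` (\<lambda>y. c *\<^sub>R U y) ` P"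
  proof -
    have "inv U (c *\<^sub>R U y) /\<^sub>R c = y" for y
      using c U by (simp add: linear_cmul[OF linU'] orthogonal_transformation_inj)
    then show ?thesis by (simp add: image_image)
  qed
  also have "\<dots> = (\<lambda>z. inv U z /\<^sub>R c) ` (convex hull ((\<lambda>x. x /\<^sub>R h) ` X))"
    by (simp only: dual)
  also have "\<dots> = convex hull ((\<lambda>z. inv U z /\<^sub>R c) ` (\<lambda>x. x /\<^sub>R h) ` X)"
    by (intro convex_hull_linear_image linear_compose_scale_right linU')
  also have "(\<lambda>z. inv U z /\<^sub>R c) ` (\<lambda>x. x /\<^sub>R h) ` X = V"
  proof -
    show ?thesis unfolding V_def image_image by (simp add: linear_cmul[OF linU'] mult.commute)
  qed
  finally show "P = convex hull V" .
qed

section \<open>The ratio of the radii and the case of equality\<close>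

lemma count_image_mset_set:
  "finite A \<Longrightarrow> count (image_mset f (mset_set A)) y = card {x \<in> A. f x = y}"
  by (simp add: count_image_mset vimage_def Int_def conj_commute)

theorem theorem6p3:
  fixes X P :: "'a::euclidean_space set" and U :: "'a \<Rightarrow> 'a" and t d n N :: nat and c h r R :: real
  assumes "d = DIM('a)" and "d \<ge> 2" and "t \<ge> 2" and "n = t div 2"
    and "spherical_design t X" and "N = card X" and "node_transitive X"
    and "minkowski_polytope X P" and "steiner_point P = 0"
    and "c > 0" and "orthogonal_transformation U"
    and "polar_body P = (\<lambda>y. c *\<^sub>R U y) ` P"
    and "\<forall>x\<in>X. support_fun P x = h"
    and "r = centered_inradius P" and "R = centered_circumradius P"
  shows "r / R = c * h\<^sup>2 \<and> c * h\<^sup>2 \<ge> quad_eta t d \<and>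
    (r / R = quad_eta t d \<longrightarrow>
      (\<forall>x\<in>X.
         (let M = image_mset (\<lambda>y. U x \<bullet> y) (mset_set X)
          in set_mset M = quad_node t d ` {..n} \<and>
             (\<forall>k\<le>n. real (count M (quad_node t d k)) = real N * quad_weight t d k)) \<and>
         real (card {v. v extreme_point_of (support_face P x)}) = real N * quad_weight t d n) \<and>
      (\<forall>k\<le>n. real N * quad_weight t d k \<in> \<int>))"
proof -
  have X: "finite X" "X \<subseteq> sphere 0 1" using assms(5) by (auto simp: spherical_design_def)
  note d = assms(1,2) and t = assms(3) and U = assms(11)
  define V where "V = (\<lambda>x. inv U x /\<^sub>R (c * h)) ` X"
  note geom = vertices_of_self_polar[OF X assms(8,13,10) U assms(12)]
  have h: "h > 0" and Xne: "X \<noteq> {}" and Peq: "P = {y. \<forall>x\<in>X. x \<bullet> y \<le> h}" and PV: "P = convex hull V"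
    using geom unfolding V_def by blast+
  have ch: "c * h > 0" using h assms(10) by simp
  have norm_V: "norm v = 1 / (c * h)" if "v \<in> V" for v
  proof -
    obtain x where x: "x \<in> X" "v = inv U x /\<^sub>R (c * h)" using \<open>v \<in> V\<close> V_def by blast
    have "norm (inv U x) = 1"
      using X(2) x(1) orthogonal_transformation_norm[OF orthogonal_transformation_inv[OF U]] by auto
    then show ?thesis using x(2) h assms(10) by (simp add: divide_inverse abs_mult)
  qed
  have V_inner: "x \<bullet> (inv U y /\<^sub>R (c * h)) = (U x \<bullet> y) / (c * h)" for x y
    by (simp add: orthogonal_transformation_adjoint_inv[OF U] divide_inverse mult.commute)
  have "r = h" using tangential_inradius[OF X(2) Xne, of h] h assms(14) Peq by simp
  moreover have "R = 1 / (c * h)"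
    using circumradius_convex_hull_sphere[of V "1 / (c * h)", OF norm_V] assms(15) PV Xne
      by (simp add: V_def)
  ultimately have ratio: "r / R = c * h\<^sup>2" by (simp add: power2_eq_square)
  have le: "U x \<bullet> y \<le> c * h\<^sup>2" if "x \<in> X" "y \<in> X" for x y
  proof -
    have "inv U y /\<^sub>R (c * h) \<in> V" unfolding V_def using that(2) by (rule imageI)
    then have "inv U y /\<^sub>R (c * h) \<in> P" unfolding PV by (rule hull_inc)
    then have "(U x \<bullet> y) / (c * h) \<le> h" unfolding Peq using that(1) V_inner by fastforce
    then show ?thesis using ch by (simp add: pos_divide_le_eq power2_eq_square mult_ac)
  qed
  have avg: "exact_averages X (\<lambda>y. U x \<bullet> y) t d" if x: "x \<in> X" for x
  proof
    have nU: "norm (U x) = 1" using X(2) x orthogonal_transformation_norm[OF U] by auto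
    show "(\<Sum>y\<in>X. poly q (U x \<bullet> y)) / real (card X) = (\<integral>s. poly q s \<partial>mu d)" if "degree q \<le> t" for q
      using design_zonal_average[OF assms(5) nU _ that] d by simp
    show "-1 \<le> U x \<bullet> y" if "y \<in> X" for y
    proof -
      have "\<bar>U x \<bullet> y\<bar> \<le> norm (U x) * norm y" by (rule Cauchy_Schwarz_ineq2)
      then show ?thesis using nU X(2) that by auto
    qed
  qed (use X Xne d t in auto)
  have bound: "c * h\<^sup>2 \<ge> quad_eta t d"
  proof -
    obtain x where x: "x \<in> X" using Xne by blast
    then obtain y where "y \<in> X" "U x \<bullet> y \<ge> quad_eta t d"
      using exact_averages.exists_value_ge_eta[OF avg[OF x]] by blast
    then show ?thesis using le[OF x] by fastforce
  qed
  have face: "card {v. v extreme_point_of (support_face P x)} = card {y \<in> X. U x \<bullet> y = c * h\<^sup>2}"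
    if x: "x \<in> X" for x
  proof -
    have face_eq: "support_face P x = P \<inter> {y. x \<bullet> y = h}"
      using assms(13) x by (auto simp: support_face_def)
    have "convex P" unfolding PV by (rule convex_convex_hull)
    then have "support_face P x face_of P"
      unfolding face_eq using Peq x by (intro face_of_Int_supporting_hyperplane_le) auto
    then have extreme: "v extreme_point_of (support_face P x) \<longleftrightarrow> v \<in> V \<and> x \<bullet> v = h" for v
      using extreme_point_of_face[of "support_face P x" P v]
        extreme_point_of_convex_hull_on_sphere[of V "1 / (c * h)" v, OF norm_V] hull_inc[of v V convex]
      unfolding face_eq PV[symmetric] by blast
    define vertex where "vertex = (\<lambda>y. inv U y /\<^sub>R (c * h))"
    have V: "V = vertex ` X" by (simp only: V_def vertex_def)
    have on_facet: "x \<bullet> vertex y = h \<longleftrightarrow> U x \<bullet> y = c * h\<^sup>2" for y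
      unfolding vertex_def V_inner
        using h assms(10) by (simp add: divide_eq_eq power2_eq_square mult_ac)
    have "{v. v extreme_point_of (support_face P x)} = vertex ` {y \<in> X. U x \<bullet> y = c * h\<^sup>2}"
      unfolding extreme V using on_facet by blast
    moreover have "inj vertex"
      using ch orthogonal_transformation_inj[OF orthogonal_transformation_inv[OF U]]
      by (auto simp: inj_def vertex_def)
    ultimately show ?thesis by (simp add: card_image inj_on_subset[of vertex UNIV])
  qed
  have equality: "(let M = image_mset (\<lambda>y. U x \<bullet> y) (mset_set X)
          in set_mset M = quad_node t d ` {..n} \<and>
             (\<forall>k\<le>n. real (count M (quad_node t d k)) = real N * quad_weight t d k)) \<and>
         real (card {v. v extreme_point_of (support_face P x)}) = real N * quad_weight t d n \<and>
      (\<forall>k\<le>n. real N * quad_weight t d k \<in> \<int>)"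
    if x: "x \<in> X" and eq: "r / R = quad_eta t d" for x
  proof -
    interpret exact_averages X "\<lambda>y. U x \<bullet> y" t d by (rule avg[OF x])
    note Q = quad_nodes_properties[OF \<open>d \<ge> 2\<close> t]
    have nodes: "U x \<bullet> y \<in> quad_nodes t d" if "y \<in> X" for y
      using le[OF x] ratio eq that by (intro values_in_nodes) auto
    have mult: "multiplicity_at k > 0" "real (multiplicity_at k) = real N * quad_weight t d k"
      if "k \<le> n" for k
      using node_multiplicities[OF nodes] that assms(4,6) by auto
    have img: "quad_node t d ` {..n} = quad_nodes t d"
      using Q(5) assms(4) by (simp add: bij_betw_def)
    have "(\<lambda>y. U x \<bullet> y) ` X = quad_node t d ` {..n}"
    proof
      show "(\<lambda>y. U x \<bullet> y) ` X \<subseteq> quad_node t d ` {..n}" using nodes img by blast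
      show "quad_node t d ` {..n} \<subseteq> (\<lambda>y. U x \<bullet> y) ` X"
      proof safe
        fix k assume "k \<le> n"
        then have "{y \<in> X. U x \<bullet> y = quad_node t d k} \<noteq> {}"
          using mult(1) by (metis card.empty less_irrefl)
        then show "quad_node t d k \<in> (\<lambda>y. U x \<bullet> y) ` X" by force
      qed
    qed
    moreover have "real (card {v. v extreme_point_of (support_face P x)}) = real N * quad_weight t d n"
      using face[OF x] mult(2)[of n] Q(6) assms(4) eq ratio by simp
    moreover have "real N * quad_weight t d k \<in> \<int>" if "k \<le> n" for k
      using mult(2)[OF that] by (metis Ints_of_nat)
    ultimately show ?thesis
      using mult(2) X(1) by (simp add: Let_def count_image_mset_set)
  qed
  show ?thesis using ratio bound equality Xne by blast
qed

end
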